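(* Let $p=p(m)$ with $m/p\to c\in(0,\infty)$ as $m,p\to\infty$. For each $m$ let $\mathbf{A}_m$ be a deterministic real $m\times p$ matrix with nonnegative entries such that $\frac{1}{mp}\operatorname{tr}(\mathbf{A}_m\mathbf{A}_m^\top)$ is uniformly bounded in $m$, and let $\mathbf{\Sigma}_m$ be a deterministic $m\times m$ positive definite covariance matrix with $\frac1m\operatorname{tr}(\mathbf{\Sigma}_m)$ bounded uniformly in $m$; let $\mathbf{\Sigma}_m^{1/2}$ be its symmetric positive definite square root. Fix an integer $n>1$ and for $k=1,\dots,n$ let $\tilde{\mathbf{A}}_m^k=\mathbf{A}_m+\mathbf{\Sigma}_m^{1/2}\mathbf{E}_m^k$, where $\mathbf{E}_m^1,\dots,\mathbf{E}_m^n$ are independent random $m\times p$ matrices with i.i.d. entries of mean zero, variance one and finite $(4+\varepsilon)$-th moment for some $\varepsilon>0$. Let $\bar{\mathbf{A}}_m=\frac1n\sum_{k=1}^n\tilde{\mathbf{A}}_m^k$ and let $\mathbf{U}_m$ be the $m\times p$ matrix of all ones. Then, as $m,p\to\infty$ with $m/p\to c$, $$\Big|\tfrac1{mp}\operatorname{tr}(\bar{\mathbf{A}}_{m} \mathbf{U}_{m}^\top)-\tfrac1{mp}\operatorname{tr}(\mathbf{A}_{m} \mathbf{U}_{m}^\top)\Big|\xrightarrow{a.s.}0,\qquad \Big|\tfrac1{mp}\operatorname{tr}(\bar{\mathbf{A}}_{m} \mathbf{A}_{m}^\top)-\tfrac1{mp}\operatorname{tr}(\mathbf{A}_{m} \mathbf{A}_{m}^\top)\Big|\xrightarrow{a.s.}0,$$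 $$\Big|\tfrac1{mp}\operatorname{tr}(\bar{\mathbf{A}}_{m} \bar{\mathbf{A}}^\top_{m})-\tfrac1{mp}\operatorname{tr}(\mathbf{A}_{m} \mathbf{A}_{m}^\top)-\tfrac{1}{nm}\operatorname{tr}(\mathbf{\Sigma}_m)\Big|\xrightarrow{a.s.}0.$$ *)

theory Defs
  imports "HOL-Probability.Probability"
begin

text \<open>Real matrices of size r x s are represented as functions nat => nat => real,
  only the entries with row index < r and column index < s being relevant.\<close>

definition tr_mult_transp :: "nat \<Rightarrow> nat \<Rightarrow> (nat \<Rightarrow> nat \<Rightarrow> real) \<Rightarrow> (nat \<Rightarrow> nat \<Rightarrow> real) \<Rightarrow> real" where
  "tr_mult_transp r s X Y = (\<Sum>i<r. \<Sum>j<s. X i j * Y i j)"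

definition mtrace :: "nat \<Rightarrow> (nat \<Rightarrow> nat \<Rightarrow> real) \<Rightarrow> real" where
  "mtrace r X = (\<Sum>i<r. X i i)"

definition mprod :: "nat \<Rightarrow> (nat \<Rightarrow> nat \<Rightarrow> real) \<Rightarrow> (nat \<Rightarrow> nat \<Rightarrow> real) \<Rightarrow> nat \<Rightarrow> nat \<Rightarrow> real" where
  "mprod q X Y = (\<lambda>i j. \<Sum>l<q. X i l * Y l j)"

definition sym_pos_def :: "nat \<Rightarrow> (nat \<Rightarrow> nat \<Rightarrow> real) \<Rightarrow> bool" where
  "sym_pos_def r S \<longleftrightarrow> (\<forall>i<r. \<forall>j<r. S i j = S j i) \<and>
     (\<forall>x::nat \<Rightarrow> real. (\<exists>i<r. x i \<noteq> 0) \<longrightarrow> (\<Sum>i<r. \<Sum>j<r. x i * S i j * x j) > 0)"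

end

theory Submission
  imports Defs
begin

text \<open>No joint law across different m is assumed, so each almost sure limit is obtained from moment
  bounds that are summable in m.  With W the averaged noise \<open>\<Sigma>\<^sup>1\<^sup>/\<^sup>2 (E\<^sup>1 + \<dots> + E\<^sup>n) / n\<close>, the three
  errors are built from tr(W U') / mp and tr(W A') / mp, which are linear forms in the noise entries, and from
  tr(W W') / mp, a quadratic form.  The squared coefficients of each form add up to O(1/m): this uses only the
  traces of A A' and \<open>\<Sigma>\<close>, through the Cauchy-Schwarz inequality
  \<open>(\<Sigma> l l')\<^sup>2 \<le> \<Sigma> l l * \<Sigma> l' l'\<close>.  Hence linear forms and the off-diagonal part of the quadratic
  form have fourth moments O(1/m^2).  The diagonal part is a weighted sum of the variables x^2 - 1, which need not
  have a fourth moment; truncating the summands at 1 leaves a part with small fourth moment and a remainder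
  with small first moment, both O(m^(1-q)) up to O(1/m^2), where q > 2 is such that |x|^(2q) is
  integrable.\<close>

section \<open>Elementary inequalities for fourth powers\<close>

lemma abs_cube_times_le: "\<bar>s ^ 3 * d\<bar> \<le> s ^ 4 + d ^ (4::nat)" for s d :: real
proof -
  have "\<bar>s\<bar> ^ 3 * \<bar>d\<bar> \<le> \<bar>s\<bar> ^ 4 + \<bar>d\<bar> ^ 4"
  proof (cases "\<bar>d\<bar> \<le> \<bar>s\<bar>")
    case True
    then have "\<bar>s\<bar> ^ 3 * \<bar>d\<bar> \<le> \<bar>s\<bar> ^ 3 * \<bar>s\<bar>" by (intro mult_left_mono) auto
    then have "\<bar>s\<bar> ^ 3 * \<bar>d\<bar> \<le> \<bar>s\<bar> ^ 4" by (simp add: eval_nat_numeral)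
    then show ?thesis by (smt (verit) zero_le_power abs_ge_zero)
  next
    case False
    then have "\<bar>s\<bar> ^ 3 * \<bar>d\<bar> \<le> \<bar>d\<bar> ^ 3 * \<bar>d\<bar>" by (intro mult_right_mono power_mono) auto
    then have "\<bar>s\<bar> ^ 3 * \<bar>d\<bar> \<le> \<bar>d\<bar> ^ 4" by (simp add: eval_nat_numeral)
    then show ?thesis by (smt (verit) zero_le_power abs_ge_zero)
  qed
  then show ?thesis by (simp add: abs_mult power_abs)
qed

lemma square_times_square_le: "s\<^sup>2 * d\<^sup>2 \<le> s ^ 4 + d ^ (4::nat)" for s d :: real
proof -
  have "0 \<le> (s\<^sup>2 - d\<^sup>2)\<^sup>2 + s ^ 4 + d ^ 4" by simp
  then show ?thesis by (simp add: power2_eq_square eval_nat_numeral algebra_simps)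
qed

text \<open>The mixed term \<open>4 * (s * y ^ 3)\<close> of the expansion is absorbed into the even
  terms: the two sides differ by \<open>2 * (y * (s - y))\<^sup>2\<close>. The term in
  \<open>s ^ 3 * y\<close> stays exact because it has mean zero once \<open>y\<close> carries an
  independent centred factor.\<close>

lemma power4_add_le: "(s + y) ^ 4 \<le> s ^ 4 + 4 * (s ^ 3 * y) + 8 * (s\<^sup>2 * y\<^sup>2) + 3 * y ^ (4::nat)" for s y :: real
proof -
  have "0 \<le> 2 * (y * (s - y))\<^sup>2" by simp
  then show ?thesis by (simp add: power2_eq_square eval_nat_numeral algebra_simps)
qed

lemma power4_add_le_8: "(s + y) ^ 4 \<le> 8 * (s ^ 4 + y ^ (4::nat))" for s y :: real
proof -
  have "s\<^sup>2 * y\<^sup>2 * 2 \<le> s ^ 4 + y ^ 4"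
    using zero_le_power2[of "s\<^sup>2 - y\<^sup>2"] by (simp add: power2_eq_square eval_nat_numeral algebra_simps)
  \<comment> \<open>Adding the mirrored power cancels the odd terms of the expansion.\<close>
  moreover have "(s + y) ^ 4 \<le> (s + y) ^ 4 + (s - y) ^ 4" by simp
  moreover have "(s + y) ^ 4 + (s - y) ^ 4 = 2 * s ^ 4 + 12 * (s\<^sup>2 * y\<^sup>2) + 2 * y ^ 4"
    by (simp add: power2_eq_square eval_nat_numeral algebra_simps)
  ultimately have "(s + y) ^ 4 \<le> 2 * s ^ 4 + 6 * (s ^ 4 + y ^ 4) + 2 * y ^ 4" by argo
  then show ?thesis by simp
qed

text \<open>A completed square; the free weights allow the two terms to be balanced when
  \<open>x\<^sup>2\<close> and \<open>y\<^sup>2\<close> have means of different size.\<close>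

lemma weighted_arith_geo_mean:
  fixes x y e d :: real
  assumes "e > 0" "d > 0"
  shows "x * y \<le> d / (2 * e) * x\<^sup>2 + e / (2 * d) * y\<^sup>2"
proof -
  have "0 \<le> (d * x - e * y)\<^sup>2 / (2 * e * d)" using assms by simp
  also have "\<dots> = d / (2 * e) * x\<^sup>2 + e / (2 * d) * y\<^sup>2 - x * y"
    using assms by (simp add: field_simps power2_eq_square)
  finally show ?thesis by simp
qed

section \<open>Fourth moments of sums, linear forms and off-diagonal forms in independent
  variables\<close>

context prob_space
begin

lemma integrable_power4_bounds:
  fixes S D :: "'a \<Rightarrow> real"
  assumes [measurable]: "S \<in> borel_measurable M" "D \<in> borel_measurable M"
    and S4: "integrable M (\<lambda>\<omega>. S \<omega> ^ 4)" and D4: "integrable M (\<lambda>\<omega>. D \<omega> ^ 4)"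
  shows "integrable M (\<lambda>\<omega>. S \<omega> ^ 3 * D \<omega>)"
    and "integrable M (\<lambda>\<omega>. (S \<omega>)\<^sup>2 * (D \<omega>)\<^sup>2)"
    and "integrable M (\<lambda>\<omega>. (S \<omega> + D \<omega>) ^ 4)"
proof -
  have I: "integrable M (\<lambda>\<omega>. S \<omega> ^ 4 + D \<omega> ^ 4)" using S4 D4 by simp
  show "integrable M (\<lambda>\<omega>. S \<omega> ^ 3 * D \<omega>)"
    by (rule Bochner_Integration.integrable_bound[OF I]) (use abs_cube_times_le in auto)
  show "integrable M (\<lambda>\<omega>. (S \<omega>)\<^sup>2 * (D \<omega>)\<^sup>2)"
    by (rule Bochner_Integration.integrable_bound[OF I]) (use square_times_square_le in auto)
  show "integrable M (\<lambda>\<omega>. (S \<omega> + D \<omega>) ^ 4)"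
    by (rule Bochner_Integration.integrable_bound[OF integrable_mult_right[OF I, of 8]])
       (use power4_add_le_8 in auto)
qed

lemma integrable_power4_imp:
  fixes X :: "'a \<Rightarrow> real"
  assumes [measurable]: "X \<in> borel_measurable M" and X4: "integrable M (\<lambda>\<omega>. X \<omega> ^ 4)"
  shows "integrable M X" and "integrable M (\<lambda>\<omega>. (X \<omega>)\<^sup>2)"
  \<comment> \<open>One of the two variables is the constant 1, which is integrable under a
    probability measure.\<close>
  using integrable_power4_bounds(1)[of "\<lambda>_. 1" X] integrable_power4_bounds(2)[of X "\<lambda>_. 1"] X4
  by auto

text \<open>The inductive step for adding one variable. The cubic term factors through
  \<open>expectation X = 0\<close> and disappears, while the even terms factor into products of
  moments. Independence of \<open>X\<close> from the pair (\<open>S\<close>, \<open>D\<close>) is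
  stated through real functions \<open>g\<close> of the pair, as both variables in
  \<open>indep_var\<close> share one value type. Taking \<open>D\<close> constant 1 serves plain
  sums; taking \<open>D\<close> a linear form serves quadratic forms.\<close>

lemma fourth_moment_add_mult_indep:
  fixes S D X :: "'a \<Rightarrow> real"
  assumes ind: "\<And>g :: real \<times> real \<Rightarrow> real. g \<in> borel_measurable (borel \<Otimes>\<^sub>M borel)
      \<Longrightarrow> indep_var borel X borel (\<lambda>\<omega>. g (S \<omega>, D \<omega>))"
    and S4: "integrable M (\<lambda>\<omega>. S \<omega> ^ 4)" and D4: "integrable M (\<lambda>\<omega>. D \<omega> ^ 4)"
    and X4: "integrable M (\<lambda>\<omega>. X \<omega> ^ 4)" and X0: "expectation X = 0"
  shows "integrable M (\<lambda>\<omega>. (S \<omega> + D \<omega> * X \<omega>) ^ 4)"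
    and "expectation (\<lambda>\<omega>. (S \<omega> + D \<omega> * X \<omega>) ^ 4) \<le> expectation (\<lambda>\<omega>. S \<omega> ^ 4)
        + 8 * (expectation (\<lambda>\<omega>. (S \<omega>)\<^sup>2 * (D \<omega>)\<^sup>2) * expectation (\<lambda>\<omega>. (X \<omega>)\<^sup>2))
        + 3 * (expectation (\<lambda>\<omega>. D \<omega> ^ 4) * expectation (\<lambda>\<omega>. X \<omega> ^ 4))"
proof -
  have X[measurable]: "X \<in> borel_measurable M" using ind[of fst] by (auto dest: indep_var_rv1)
  have S[measurable]: "S \<in> borel_measurable M" using ind[of fst] by (auto dest: indep_var_rv2)
  have D[measurable]: "D \<in> borel_measurable M" using ind[of snd] by (auto dest: indep_var_rv2)
  have ind': "indep_var borel (\<lambda>\<omega>. f (X \<omega>)) borel (\<lambda>\<omega>. g (S \<omega>) (D \<omega>))"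
    if "f \<in> borel_measurable borel" "case_prod g \<in> borel_measurable (borel \<Otimes>\<^sub>M borel)"
    for f :: "real \<Rightarrow> real" and g :: "real \<Rightarrow> real \<Rightarrow> real"
    using indep_var_compose[OF ind[OF that(2)] that(1) measurable_ident] by (simp add: comp_def id_def)
  note Xi = integrable_power4_imp[OF X X4]
  note i31 = integrable_power4_bounds(1)[OF S D S4 D4]
  note i22 = integrable_power4_bounds(2)[OF S D S4 D4]
  have ind1: "indep_var borel X borel (\<lambda>\<omega>. S \<omega> ^ 3 * D \<omega>)"
    by (rule ind'[of "\<lambda>x. x" "\<lambda>s d. s ^ 3 * d"]) measurable
  have ind2: "indep_var borel (\<lambda>\<omega>. (X \<omega>)\<^sup>2) borel (\<lambda>\<omega>. (S \<omega>)\<^sup>2 * (D \<omega>)\<^sup>2)"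
    by (rule ind'[of "\<lambda>x. x\<^sup>2" "\<lambda>s d. s\<^sup>2 * d\<^sup>2"]) measurable
  have ind3: "indep_var borel (\<lambda>\<omega>. X \<omega> ^ 4) borel (\<lambda>\<omega>. D \<omega> ^ 4)"
    by (rule ind'[of "\<lambda>x. x ^ 4" "\<lambda>s d. d ^ 4"]) measurable
  have I1: "integrable M (\<lambda>\<omega>. S \<omega> ^ 3 * (D \<omega> * X \<omega>))"
    and E1: "expectation (\<lambda>\<omega>. S \<omega> ^ 3 * (D \<omega> * X \<omega>)) = 0"
    using indep_var_integrable[OF ind1 Xi(1) i31] indep_var_lebesgue_integral[OF ind1 Xi(1) i31] X0
    by (simp_all add: ac_simps)
  have I2: "integrable M (\<lambda>\<omega>. (S \<omega>)\<^sup>2 * (D \<omega> * X \<omega>)\<^sup>2)"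
    and E2: "expectation (\<lambda>\<omega>. (S \<omega>)\<^sup>2 * (D \<omega> * X \<omega>)\<^sup>2)
      = expectation (\<lambda>\<omega>. (S \<omega>)\<^sup>2 * (D \<omega>)\<^sup>2) * expectation (\<lambda>\<omega>. (X \<omega>)\<^sup>2)"
    using indep_var_integrable[OF ind2 Xi(2) i22] indep_var_lebesgue_integral[OF ind2 Xi(2) i22]
    by (simp_all add: power_mult_distrib ac_simps)
  have I3: "integrable M (\<lambda>\<omega>. (D \<omega> * X \<omega>) ^ 4)"
    and E3: "expectation (\<lambda>\<omega>. (D \<omega> * X \<omega>) ^ 4)
      = expectation (\<lambda>\<omega>. D \<omega> ^ 4) * expectation (\<lambda>\<omega>. X \<omega> ^ 4)"
    using indep_var_integrable[OF ind3 X4 D4] indep_var_lebesgue_integral[OF ind3 X4 D4]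
    by (simp_all add: power_mult_distrib ac_simps)
  show I: "integrable M (\<lambda>\<omega>. (S \<omega> + D \<omega> * X \<omega>) ^ 4)"
    by (rule integrable_power4_bounds(3)) (use S4 I3 in auto)
  have "expectation (\<lambda>\<omega>. (S \<omega> + D \<omega> * X \<omega>) ^ 4) \<le>
     expectation (\<lambda>\<omega>. S \<omega> ^ 4 + 4 * (S \<omega> ^ 3 * (D \<omega> * X \<omega>)) + 8 * ((S \<omega>)\<^sup>2 * (D \<omega> * X \<omega>)\<^sup>2)
        + 3 * (D \<omega> * X \<omega>) ^ 4)"
    by (rule integral_mono[OF I]) (use S4 I1 I2 I3 power4_add_le in auto)
  also have "\<dots> = expectation (\<lambda>\<omega>. S \<omega> ^ 4) + 4 * expectation (\<lambda>\<omega>. S \<omega> ^ 3 * (D \<omega> * X \<omega>))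
      + 8 * expectation (\<lambda>\<omega>. (S \<omega>)\<^sup>2 * (D \<omega> * X \<omega>)\<^sup>2) + 3 * expectation (\<lambda>\<omega>. (D \<omega> * X \<omega>) ^ 4)"
    using S4 I1 I2 I3 by (simp del: power_mult_distrib)
  finally show "expectation (\<lambda>\<omega>. (S \<omega> + D \<omega> * X \<omega>) ^ 4) \<le> expectation (\<lambda>\<omega>. S \<omega> ^ 4)
        + 8 * (expectation (\<lambda>\<omega>. (S \<omega>)\<^sup>2 * (D \<omega>)\<^sup>2) * expectation (\<lambda>\<omega>. (X \<omega>)\<^sup>2))
        + 3 * (expectation (\<lambda>\<omega>. D \<omega> ^ 4) * expectation (\<lambda>\<omega>. X \<omega> ^ 4))"
    unfolding E1 E2 E3 by simp
qed

text \<open>The blocks \<open>{t}\<close> and \<open>F\<close> of the family are disjoint, hence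
  independent, and \<open>g\<close> sees only the second one. This supplies the independence
  hypothesis of the inductive steps.\<close>

lemma indep_var_fun_of_rest:
  assumes ind: "indep_vars (\<lambda>_. borel) X (insert t F)" and t: "t \<notin> F"
    and f: "f \<in> borel_measurable (PiM F (\<lambda>_. borel))" and g: "\<And>\<omega>. g \<omega> = f (\<lambda>i\<in>F. X i \<omega>)"
  shows "indep_var borel (X t :: 'a \<Rightarrow> real) borel (g :: 'a \<Rightarrow> real)"
proof -
  have "indep_var borel ((\<lambda>h. h t) \<circ> (\<lambda>\<omega>. \<lambda>i\<in>{t}. X i \<omega>)) borel (f \<circ> (\<lambda>\<omega>. \<lambda>i\<in>F. X i \<omega>))"
    by (rule indep_var_compose[OF indep_var_restrict[OF ind] _ f]) (use t in auto)
  moreover have "(\<lambda>h. h t) \<circ> (\<lambda>\<omega>. \<lambda>i\<in>{t}. X i \<omega>) = X t" by auto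
  moreover have "f \<circ> (\<lambda>\<omega>. \<lambda>i\<in>F. X i \<omega>) = g" using g by (auto simp: comp_def)
  ultimately show ?thesis by simp
qed

text \<open>Induction on \<open>F\<close>. The variance identity is carried along because the mixed
  term of each step needs the second moment of the partial sum.\<close>

lemma fourth_moment_sum_indep:
  fixes Z :: "'i \<Rightarrow> 'a \<Rightarrow> real"
  assumes "finite F" "indep_vars (\<lambda>_. borel) Z F"
    and "\<And>i. i \<in> F \<Longrightarrow> integrable M (\<lambda>\<omega>. Z i \<omega> ^ 4)"
    and "\<And>i. i \<in> F \<Longrightarrow> expectation (Z i) = 0"
  shows "integrable M (\<lambda>\<omega>. (\<Sum>i\<in>F. Z i \<omega>) ^ 4)
    \<and> expectation (\<lambda>\<omega>. (\<Sum>i\<in>F. Z i \<omega>)\<^sup>2) = (\<Sum>i\<in>F. expectation (\<lambda>\<omega>. (Z i \<omega>)\<^sup>2))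
    \<and> expectation (\<lambda>\<omega>. (\<Sum>i\<in>F. Z i \<omega>) ^ 4)
        \<le> 4 * (\<Sum>i\<in>F. expectation (\<lambda>\<omega>. (Z i \<omega>)\<^sup>2))\<^sup>2 + 3 * (\<Sum>i\<in>F. expectation (\<lambda>\<omega>. Z i \<omega> ^ 4))"
  using assms
proof (induction F rule: finite_induct)
  case empty
  then show ?case by simp
next
  case (insert t F)
  define S where "S \<omega> = (\<Sum>i\<in>F. Z i \<omega>)" for \<omega>
  have rv[measurable]: "\<And>i. i \<in> insert t F \<Longrightarrow> Z i \<in> borel_measurable M"
    using insert.prems(1) by (auto simp: indep_vars_def)
  have Sm[measurable]: "S \<in> borel_measurable M" unfolding S_def[abs_def] by measurable
  have IH: "integrable M (\<lambda>\<omega>. S \<omega> ^ 4)"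
    "expectation (\<lambda>\<omega>. (S \<omega>)\<^sup>2) = (\<Sum>i\<in>F. expectation (\<lambda>\<omega>. (Z i \<omega>)\<^sup>2))"
    "expectation (\<lambda>\<omega>. S \<omega> ^ 4)
        \<le> 4 * (\<Sum>i\<in>F. expectation (\<lambda>\<omega>. (Z i \<omega>)\<^sup>2))\<^sup>2 + 3 * (\<Sum>i\<in>F. expectation (\<lambda>\<omega>. Z i \<omega> ^ 4))"
    using insert.IH insert.prems indep_vars_subset[OF insert.prems(1), of F]
    unfolding S_def by auto
  have ind1: "indep_var borel (Z t) borel (\<lambda>\<omega>. g (S \<omega>, 1))"
    if [measurable]: "g \<in> borel_measurable (borel \<Otimes>\<^sub>M borel)" for g :: "real \<times> real \<Rightarrow> real"
    by (rule indep_var_fun_of_rest[OF insert.prems(1) insert.hyps(2), where f = "\<lambda>h. g (\<Sum>i\<in>F. h i, 1)"])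
       (auto simp: S_def)
  have ind2: "indep_var borel (Z t) borel S"
    by (rule indep_var_fun_of_rest[OF insert.prems(1) insert.hyps(2), where f = "\<lambda>h. (\<Sum>i\<in>F. h i)"])
       (auto simp: S_def)
  have Z4: "integrable M (\<lambda>\<omega>. Z t \<omega> ^ 4)" and Z0: "expectation (Z t) = 0" using insert.prems by auto
  have Ztm[measurable]: "Z t \<in> borel_measurable M" using rv by auto
  note Zi = integrable_power4_imp[OF Ztm Z4]
  note Si = integrable_power4_imp[OF Sm IH(1)]
  note step = fourth_moment_add_mult_indep[OF ind1 IH(1) _ Z4 Z0]
  have sum_eq: "(\<Sum>i\<in>insert t F. Z i \<omega>) = S \<omega> + Z t \<omega>" for \<omega>
    using insert.hyps by (simp add: S_def)
  have EZS: "expectation (\<lambda>\<omega>. Z t \<omega> * S \<omega>) = 0" and IZS: "integrable M (\<lambda>\<omega>. Z t \<omega> * S \<omega>)"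
    using indep_var_lebesgue_integral[OF ind2 Zi(1) Si(1)] indep_var_integrable[OF ind2 Zi(1) Si(1)] Z0
    by simp_all
  have E2: "expectation (\<lambda>\<omega>. (S \<omega> + Z t \<omega>)\<^sup>2) = expectation (\<lambda>\<omega>. (S \<omega>)\<^sup>2) + expectation (\<lambda>\<omega>. (Z t \<omega>)\<^sup>2)"
  proof -
    have "expectation (\<lambda>\<omega>. (S \<omega> + Z t \<omega>)\<^sup>2)
      = expectation (\<lambda>\<omega>. (S \<omega>)\<^sup>2 + (Z t \<omega>)\<^sup>2 + 2 * (Z t \<omega> * S \<omega>))"
      by (simp add: power2_sum ac_simps)
    also have "\<dots> = expectation (\<lambda>\<omega>. (S \<omega>)\<^sup>2) + expectation (\<lambda>\<omega>. (Z t \<omega>)\<^sup>2)"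
      using Si Zi IZS EZS by simp
    finally show ?thesis .
  qed
  define V where "V = (\<Sum>i\<in>F. expectation (\<lambda>\<omega>. (Z i \<omega>)\<^sup>2))"
  define v where "v = expectation (\<lambda>\<omega>. (Z t \<omega>)\<^sup>2)"
  have "expectation (\<lambda>\<omega>. (S \<omega> + Z t \<omega>) ^ 4)
     \<le> expectation (\<lambda>\<omega>. S \<omega> ^ 4) + 8 * (V * v) + 3 * expectation (\<lambda>\<omega>. Z t \<omega> ^ 4)"
    using step(2) IH(2) by (simp add: V_def v_def prob_space)
  \<comment> \<open>The mixed term completes the square,
    \<open>4 * V\<^sup>2 + 8 * (V * v) \<le> 4 * (V + v)\<^sup>2\<close>; this is where the constant
    4 comes from.\<close>
  also have "\<dots> \<le> 4 * (V + v)\<^sup>2 + 3 * ((\<Sum>i\<in>F. expectation (\<lambda>\<omega>. Z i \<omega> ^ 4)) + expectation (\<lambda>\<omega>. Z t \<omega> ^ 4))"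
    using IH(3) zero_le_power2[of v] unfolding V_def[symmetric] power2_sum by argo
  finally have "expectation (\<lambda>\<omega>. (S \<omega> + Z t \<omega>) ^ 4) \<le> 4 * (V + v)\<^sup>2
      + 3 * ((\<Sum>i\<in>F. expectation (\<lambda>\<omega>. Z i \<omega> ^ 4)) + expectation (\<lambda>\<omega>. Z t \<omega> ^ 4))" .
  then show ?case
    unfolding sum_eq using step(1) E2 IH(2) insert.hyps by (simp add: V_def v_def ac_simps)
qed

text \<open>The weighted terms have second moments \<open>(a i)\<^sup>2\<close> and fourth moments
  at most \<open>a i ^ 4 * m4\<close>, and the sum of the \<open>a i ^ 4\<close> is at most the
  square of the sum of the \<open>(a i)\<^sup>2\<close>.\<close>

lemma fourth_moment_linear_form:
  fixes X :: "'i \<Rightarrow> 'a \<Rightarrow> real"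
  assumes F: "finite F" and ind: "indep_vars (\<lambda>_. borel) X F" and m4: "0 \<le> m4"
    and X4: "\<And>i. i \<in> F \<Longrightarrow> integrable M (\<lambda>\<omega>. X i \<omega> ^ 4)"
    and X0: "\<And>i. i \<in> F \<Longrightarrow> expectation (X i) = 0"
    and X2: "\<And>i. i \<in> F \<Longrightarrow> expectation (\<lambda>\<omega>. (X i \<omega>)\<^sup>2) = 1"
    and X4_le: "\<And>i. i \<in> F \<Longrightarrow> expectation (\<lambda>\<omega>. X i \<omega> ^ 4) \<le> m4"
  shows "integrable M (\<lambda>\<omega>. (\<Sum>i\<in>F. a i * X i \<omega>) ^ 4)"
    and "expectation (\<lambda>\<omega>. (\<Sum>i\<in>F. a i * X i \<omega>) ^ 4) \<le> (4 + 3 * m4) * (\<Sum>i\<in>F. (a i)\<^sup>2)\<^sup>2"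
proof -
  have indZ: "indep_vars (\<lambda>_. borel) (\<lambda>i \<omega>. a i * X i \<omega>) F"
    by (rule indep_vars_compose2[OF ind, where Y = "\<lambda>i x. a i * x"]) auto
  have Z: "integrable M (\<lambda>\<omega>. (a i * X i \<omega>) ^ 4)" "expectation (\<lambda>\<omega>. a i * X i \<omega>) = 0"
    "expectation (\<lambda>\<omega>. (a i * X i \<omega>)\<^sup>2) = (a i)\<^sup>2"
    "expectation (\<lambda>\<omega>. (a i * X i \<omega>) ^ 4) \<le> a i ^ 4 * m4" if "i \<in> F" for i
    using X4 X0 X2 X4_le that by (auto simp: power_mult_distrib intro!: mult_left_mono)
  note W = fourth_moment_sum_indep[OF F indZ Z(1,2)]
  show "integrable M (\<lambda>\<omega>. (\<Sum>i\<in>F. a i * X i \<omega>) ^ 4)" using W by simp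
  have "(\<Sum>i\<in>F. expectation (\<lambda>\<omega>. (a i * X i \<omega>) ^ 4)) \<le> (\<Sum>i\<in>F. a i ^ 4 * m4)"
    by (rule sum_mono) (use Z in auto)
  also have "\<dots> = (\<Sum>i\<in>F. (a i)\<^sup>2 * (a i)\<^sup>2) * m4"
    by (simp add: sum_distrib_right flip: power_add)
  also have "\<dots> \<le> (\<Sum>i\<in>F. (a i)\<^sup>2 * (\<Sum>i\<in>F. (a i)\<^sup>2)) * m4"
    by (intro mult_right_mono sum_mono mult_left_mono member_le_sum m4) (use F in auto)
  also have "\<dots> = (\<Sum>i\<in>F. (a i)\<^sup>2)\<^sup>2 * m4" by (simp add: sum_distrib_right power2_eq_square)
  finally have "(\<Sum>i\<in>F. expectation (\<lambda>\<omega>. (a i * X i \<omega>) ^ 4)) \<le> (\<Sum>i\<in>F. (a i)\<^sup>2)\<^sup>2 * m4" .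
  moreover have "(\<Sum>i\<in>F. expectation (\<lambda>\<omega>. (a i * X i \<omega>)\<^sup>2)) = (\<Sum>i\<in>F. (a i)\<^sup>2)"
    by (rule sum.cong) (use Z(3) in auto)
  moreover have "expectation (\<lambda>\<omega>. (\<Sum>i\<in>F. a i * X i \<omega>) ^ 4)
      \<le> 4 * (\<Sum>i\<in>F. expectation (\<lambda>\<omega>. (a i * X i \<omega>)\<^sup>2))\<^sup>2
        + 3 * (\<Sum>i\<in>F. expectation (\<lambda>\<omega>. (a i * X i \<omega>) ^ 4))"
    using W by blast
  ultimately show "expectation (\<lambda>\<omega>. (\<Sum>i\<in>F. a i * X i \<omega>) ^ 4) \<le> (4 + 3 * m4) * (\<Sum>i\<in>F. (a i)\<^sup>2)\<^sup>2"
    unfolding distrib_right mult.assoc by (simp add: mult.commute)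
qed

text \<open>Cauchy-Schwarz for \<open>S\<^sup>2\<close> and \<open>D\<^sup>2\<close>, with
  \<open>e\<close> and \<open>d\<close> as bounds of their L2 norms.\<close>

lemma square_expectation_prod_le:
  fixes S D :: "'a \<Rightarrow> real"
  assumes [measurable]: "S \<in> borel_measurable M" "D \<in> borel_measurable M"
    and S4: "integrable M (\<lambda>\<omega>. S \<omega> ^ 4)" and D4: "integrable M (\<lambda>\<omega>. D \<omega> ^ 4)"
    and e: "expectation (\<lambda>\<omega>. S \<omega> ^ 4) \<le> e\<^sup>2" and d: "expectation (\<lambda>\<omega>. D \<omega> ^ 4) \<le> d\<^sup>2"
    and nn: "0 \<le> e" "0 \<le> d"
  shows "expectation (\<lambda>\<omega>. (S \<omega>)\<^sup>2 * (D \<omega>)\<^sup>2) \<le> e * d"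
proof -
  note I22 = integrable_power4_bounds(2)[OF assms(1-4)]
  \<comment> \<open>The weights divide by \<open>e\<close> and \<open>d\<close>, which may be zero,
    so both are raised by a positive \<open>\<delta>\<close> that is sent to zero
    afterwards.\<close>
  have key: "expectation (\<lambda>\<omega>. (S \<omega>)\<^sup>2 * (D \<omega>)\<^sup>2) \<le> (e + \<delta>) * (d + \<delta>)" if "\<delta> > 0" for \<delta>
  proof -
    let ?e = "e + \<delta>" and ?d = "d + \<delta>"
    have pos: "?e > 0" "?d > 0" using nn that by auto
    \<comment> \<open>AM-GM, weighted so that both terms integrate to at most half of the product\<close>
    have pw: "(S \<omega>)\<^sup>2 * (D \<omega>)\<^sup>2 \<le> (?d / (2 * ?e)) * S \<omega> ^ 4 + (?e / (2 * ?d)) * D \<omega> ^ 4" for \<omega>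
      using weighted_arith_geo_mean[OF pos, of "(S \<omega>)\<^sup>2" "(D \<omega>)\<^sup>2"] by (simp flip: power_mult)
    have "expectation (\<lambda>\<omega>. (S \<omega>)\<^sup>2 * (D \<omega>)\<^sup>2)
       \<le> expectation (\<lambda>\<omega>. (?d / (2 * ?e)) * S \<omega> ^ 4 + (?e / (2 * ?d)) * D \<omega> ^ 4)"
      by (rule integral_mono[OF I22 _ pw]) (use S4 D4 in auto)
    also have "\<dots> = (?d / (2 * ?e)) * expectation (\<lambda>\<omega>. S \<omega> ^ 4) + (?e / (2 * ?d)) * expectation (\<lambda>\<omega>. D \<omega> ^ 4)"
      using S4 D4 by simp
    also have "\<dots> \<le> (?d / (2 * ?e)) * ?e\<^sup>2 + (?e / (2 * ?d)) * ?d\<^sup>2"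
    proof (intro add_mono mult_left_mono)
      show "expectation (\<lambda>\<omega>. S \<omega> ^ 4) \<le> ?e\<^sup>2"
        using e power_mono[of e ?e 2] nn that by linarith
      show "expectation (\<lambda>\<omega>. D \<omega> ^ 4) \<le> ?d\<^sup>2"
        using d power_mono[of d ?d 2] nn that by linarith
    qed (use pos in auto)
    also have "\<dots> = ?e * ?d / 2 + ?e * ?d / 2"
      using pos by (intro arg_cong2[where f = "(+)"]) (simp_all add: power2_eq_square del: distrib_left_numeral)
    also have "\<dots> = ?e * ?d" by simp
    finally show ?thesis .
  qed
  have "((\<lambda>\<delta>. (e + \<delta>) * (d + \<delta>)) \<longlongrightarrow> (e + 0) * (d + 0)) (at_right 0)"
    by (intro tendsto_intros)
  then have "expectation (\<lambda>\<omega>. (S \<omega>)\<^sup>2 * (D \<omega>)\<^sup>2) \<le> (e + 0) * (d + 0)"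
    by (rule tendsto_lowerbound) (use key in \<open>auto simp: eventually_at_filter\<close>)
  then show ?thesis by simp
qed

lemma fourth_moment_off_diagonal_form:
  fixes X :: "'i \<Rightarrow> 'a \<Rightarrow> real" and b :: "'i \<Rightarrow> 'i \<Rightarrow> real"
  assumes m4: "0 \<le> m4"
  assumes "finite F" "indep_vars (\<lambda>_. borel) X F"
    and "\<And>i. i \<in> F \<Longrightarrow> integrable M (\<lambda>\<omega>. X i \<omega> ^ 4)"
    and "\<And>i. i \<in> F \<Longrightarrow> expectation (X i) = 0"
    and "\<And>i. i \<in> F \<Longrightarrow> expectation (\<lambda>\<omega>. (X i \<omega>)\<^sup>2) = 1"
    and "\<And>i. i \<in> F \<Longrightarrow> expectation (\<lambda>\<omega>. X i \<omega> ^ 4) \<le> m4"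
  shows "integrable M (\<lambda>\<omega>. (\<Sum>s\<in>F. \<Sum>t\<in>F - {s}. b s t * (X s \<omega> * X t \<omega>)) ^ 4)
    \<and> expectation (\<lambda>\<omega>. (\<Sum>s\<in>F. \<Sum>t\<in>F - {s}. b s t * (X s \<omega> * X t \<omega>)) ^ 4)
        \<le> (2 * (4 + 3 * m4)\<^sup>2 * (\<Sum>s\<in>F. \<Sum>t\<in>F - {s}. (b s t)\<^sup>2))\<^sup>2"
  using assms(2-)
proof (induction F rule: finite_induct)
  case empty
  then show ?case by simp
next
  case (insert t F)
  define k where "k = 4 + 3 * m4"
  have k: "k \<ge> 4" "k \<ge> 3 * m4" using m4 by (auto simp: k_def)
  \<comment> \<open>Adding the index \<open>t\<close> changes the form by \<open>D * X t\<close>, where \<open>D\<close> is a linear form in the other variables.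
    In terms of the square roots \<open>e\<close> and \<open>d\<close> of the fourth moments of the form and of \<open>D\<close>, this costs at most
    the additive term \<open>k * d\<close>.\<close>
  have split: "(\<Sum>s\<in>insert t F. \<Sum>u\<in>insert t F - {s}. g s u)
      = (\<Sum>s\<in>F. \<Sum>u\<in>F - {s}. g s u) + (\<Sum>s\<in>F. g s t + g t s)" for g :: "'i \<Rightarrow> 'i \<Rightarrow> real"
  proof -
    have "(\<Sum>u\<in>insert t F - {s}. g s u) = g s t + (\<Sum>u\<in>F - {s}. g s u)" if "s \<in> F" for s
    proof -
      have "insert t F - {s} = insert t (F - {s})" using that insert.hyps by auto
      then show ?thesis using insert.hyps by simp
    qed
    moreover have "insert t F - {t} = F" using insert.hyps by auto
    ultimately show ?thesis using insert.hyps by (simp add: sum.distrib)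
  qed
  define S where "S \<omega> = (\<Sum>s\<in>F. \<Sum>u\<in>F - {s}. b s u * (X s \<omega> * X u \<omega>))" for \<omega>
  define D where "D \<omega> = (\<Sum>s\<in>F. (b s t + b t s) * X s \<omega>)" for \<omega>
  have rv[measurable]: "\<And>i. i \<in> insert t F \<Longrightarrow> X i \<in> borel_measurable M"
    using insert.prems(1) by (auto simp: indep_vars_def)
  have Sm[measurable]: "S \<in> borel_measurable M"
    unfolding S_def[abs_def] by (intro borel_measurable_sum borel_measurable_times) (auto intro: rv)
  have Dm[measurable]: "D \<in> borel_measurable M"
    unfolding D_def[abs_def] by (intro borel_measurable_sum borel_measurable_times) (auto intro: rv)
  have sum_eq: "(\<Sum>s\<in>insert t F. \<Sum>u\<in>insert t F - {s}. b s u * (X s \<omega> * X u \<omega>)) = S \<omega> + D \<omega> * X t \<omega>" for \<omega>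
    unfolding split S_def D_def sum_distrib_right by (intro arg_cong2[where f = "(+)"] sum.cong) (simp_all add: algebra_simps)
  define e where "e = 2 * k\<^sup>2 * (\<Sum>s\<in>F. \<Sum>u\<in>F - {s}. (b s u)\<^sup>2)"
  define d where "d = k * (\<Sum>s\<in>F. (b s t + b t s)\<^sup>2)"
  have nn: "e \<ge> 0" "d \<ge> 0" using k by (auto simp: e_def d_def intro!: sum_nonneg mult_nonneg_nonneg)
  have indF: "indep_vars (\<lambda>_. borel) X F" by (rule indep_vars_subset[OF insert.prems(1)]) auto
  have IH: "integrable M (\<lambda>\<omega>. S \<omega> ^ 4)" "expectation (\<lambda>\<omega>. S \<omega> ^ 4) \<le> e\<^sup>2"
    using insert.IH[OF indF] insert.prems unfolding S_def e_def k_def by auto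
  have D4: "integrable M (\<lambda>\<omega>. D \<omega> ^ 4)"
    and "expectation (\<lambda>\<omega>. D \<omega> ^ 4) \<le> k * (\<Sum>s\<in>F. (b s t + b t s)\<^sup>2)\<^sup>2"
    using fourth_moment_linear_form[OF insert.hyps(1) indF m4, of "\<lambda>s. b s t + b t s"] insert.prems(2-5)
    unfolding D_def k_def by auto
  note this(2)
  \<comment> \<open>A further factor \<open>k \<ge> 1\<close> turns the bound into the perfect
    square \<open>d\<^sup>2\<close>.\<close>
  also have "k * (\<Sum>s\<in>F. (b s t + b t s)\<^sup>2)\<^sup>2 \<le> k\<^sup>2 * (\<Sum>s\<in>F. (b s t + b t s)\<^sup>2)\<^sup>2"
    using k by (intro mult_right_mono) (auto simp: power2_eq_square)
  finally have D4': "expectation (\<lambda>\<omega>. D \<omega> ^ 4) \<le> d\<^sup>2" by (simp add: d_def power_mult_distrib)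
  have ind: "indep_var borel (X t) borel (\<lambda>\<omega>. g (S \<omega>, D \<omega>))"
    if g: "g \<in> borel_measurable (borel \<Otimes>\<^sub>M borel)" for g :: "real \<times> real \<Rightarrow> real"
  proof (rule indep_var_fun_of_rest[OF insert.prems(1) insert.hyps(2)])
    let ?f = "\<lambda>h. (\<Sum>s\<in>F. \<Sum>u\<in>F - {s}. b s u * (h s * h u), \<Sum>s\<in>F. (b s t + b t s) * h s)"
    have "?f \<in> PiM F (\<lambda>_. borel) \<rightarrow>\<^sub>M borel \<Otimes>\<^sub>M borel"
      by (intro measurable_Pair borel_measurable_sum borel_measurable_times) auto
    from measurable_compose[OF this g]
    show "(\<lambda>h. g (?f h)) \<in> borel_measurable (PiM F (\<lambda>_. borel))" .
    show "g (S \<omega>, D \<omega>) = g (?f (\<lambda>i\<in>F. X i \<omega>))" for \<omega>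
      by (auto simp: S_def D_def intro!: arg_cong[where f = g] sum.cong)
  qed
  have X4: "integrable M (\<lambda>\<omega>. X t \<omega> ^ 4)" "expectation (X t) = 0"
    "expectation (\<lambda>\<omega>. (X t \<omega>)\<^sup>2) = 1" "expectation (\<lambda>\<omega>. X t \<omega> ^ 4) \<le> m4"
    using insert.prems by auto
  note step = fourth_moment_add_mult_indep[OF ind IH(1) D4 X4(1,2)]
  have "expectation (\<lambda>\<omega>. (S \<omega> + D \<omega> * X t \<omega>) ^ 4) \<le> e\<^sup>2 + 8 * (e * d) + 3 * (d\<^sup>2 * m4)"
  proof -
    have "expectation (\<lambda>\<omega>. D \<omega> ^ 4) * expectation (\<lambda>\<omega>. X t \<omega> ^ 4) \<le> d\<^sup>2 * m4"
      using D4' X4(4) by (intro mult_mono) (auto intro!: integral_nonneg)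
    moreover have "expectation (\<lambda>\<omega>. (S \<omega>)\<^sup>2 * (D \<omega>)\<^sup>2) \<le> e * d"
      by (rule square_expectation_prod_le[OF Sm Dm IH(1) D4 IH(2) D4' nn])
    ultimately show ?thesis using step(2) IH(2) X4(3) by simp
  qed
  \<comment> \<open>Compared term by term with the expanded square: \<open>8 \<le> 2 * k\<close>
    because \<open>k \<ge> 4\<close>, and \<open>3 * m4 \<le> k \<le> k\<^sup>2\<close>.\<close>
  also have "\<dots> \<le> (e + k * d)\<^sup>2"
  proof -
    have "8 * (e * d) \<le> 2 * k * (e * d)" using k nn by (intro mult_right_mono) auto
    moreover have "3 * m4 * d\<^sup>2 \<le> k\<^sup>2 * d\<^sup>2"
    proof (rule mult_right_mono)
      have "k * 1 \<le> k * k" using k by (intro mult_left_mono) auto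
      then have "k \<le> k\<^sup>2" by (simp add: power2_eq_square)
      then show "3 * m4 \<le> k\<^sup>2" using k by linarith
    qed simp
    ultimately show ?thesis by (simp add: power2_sum power_mult_distrib algebra_simps)
  qed
  \<comment> \<open>The coefficients of \<open>D\<close> are \<open>b s t + b t s\<close>, whose
    square is at most twice the sum of the two squares; hence the factor 2. One factor
    \<open>k\<close> sits in \<open>d\<close>, the other multiplies it.\<close>
  also have "\<dots> \<le> (2 * k\<^sup>2 * (\<Sum>s\<in>insert t F. \<Sum>u\<in>insert t F - {s}. (b s u)\<^sup>2))\<^sup>2"
  proof (rule power_mono)
    have "(\<Sum>s\<in>F. (b s t + b t s)\<^sup>2) \<le> (\<Sum>s\<in>F. 2 * ((b s t)\<^sup>2 + (b t s)\<^sup>2))"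
    proof (rule sum_mono)
      fix s
      show "(b s t + b t s)\<^sup>2 \<le> 2 * ((b s t)\<^sup>2 + (b t s)\<^sup>2)"
        using zero_le_power2[of "b s t - b t s"] by (simp add: power2_sum power2_diff)
    qed
    then have "k\<^sup>2 * (\<Sum>s\<in>F. (b s t + b t s)\<^sup>2) \<le> k\<^sup>2 * (2 * (\<Sum>s\<in>F. (b s t)\<^sup>2 + (b t s)\<^sup>2))"
      by (intro mult_left_mono) (auto simp: sum_distrib_left)
    then show "e + k * d \<le> 2 * k\<^sup>2 * (\<Sum>s\<in>insert t F. \<Sum>u\<in>insert t F - {s}. (b s u)\<^sup>2)"
      unfolding split e_def d_def by (simp add: algebra_simps power2_eq_square)
    show "0 \<le> e + k * d" using nn k by simp
  qed
  finally show ?case unfolding sum_eq using step(1) by (simp add: k_def)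
qed

section \<open>Almost sure convergence from summable expectations, and truncation\<close>

lemma AE_tendsto_zero_of_summable_expectation:
  fixes f :: "nat \<Rightarrow> 'a \<Rightarrow> real"
  assumes int: "\<And>m. m \<ge> m0 \<Longrightarrow> integrable M (f m)" and nn: "\<And>m \<omega>. 0 \<le> f m \<omega>"
    and le: "\<And>m. m \<ge> m0 \<Longrightarrow> expectation (f m) \<le> g m" and g: "summable g"
  shows "AE \<omega> in M. (\<lambda>m. f m \<omega>) \<longlonglongrightarrow> 0"
proof -
  have meas[measurable]: "f (m + m0) \<in> borel_measurable M" for m using int[of "m + m0"] by auto
  have g0: "0 \<le> g (m + m0)" for m
    using order_trans[OF Bochner_Integration.integral_nonneg le[of "m + m0"]] nn by auto
  \<comment> \<open>Expectation and series commute for nonnegative terms, so the series has finite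
    expectation. It therefore converges almost surely, and its terms tend to zero, whatever the
    dependence between different \<open>m\<close>. The shift by \<open>m0\<close> restricts to the
    range where the bounds hold.\<close>
  have "(\<integral>\<^sup>+ \<omega>. (\<Sum>m. ennreal (f (m + m0) \<omega>)) \<partial>M) = (\<Sum>m. \<integral>\<^sup>+ \<omega>. ennreal (f (m + m0) \<omega>) \<partial>M)"
    by (rule nn_integral_suminf) auto
  also have "\<dots> \<le> (\<Sum>m. ennreal (g (m + m0)))"
  proof (rule suminf_le)
    show "(\<integral>\<^sup>+ \<omega>. ennreal (f (m + m0) \<omega>) \<partial>M) \<le> ennreal (g (m + m0))" for m
      using nn_integral_eq_integral[OF int[of "m + m0"]] nn le[of "m + m0"] by (simp add: ennreal_leI)
  qed auto
  finally have "(\<integral>\<^sup>+ \<omega>. (\<Sum>m. ennreal (f (m + m0) \<omega>)) \<partial>M) \<noteq> \<infinity>"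
    using ennreal_suminf_neq_top[OF summable_ignore_initial_segment[OF g, of m0] g0]
    by (auto simp: top_unique)
  then have "AE \<omega> in M. (\<Sum>m. ennreal (f (m + m0) \<omega>)) \<noteq> \<infinity>"
    by (intro nn_integral_noteq_infinite) auto
  then show ?thesis
  proof eventually_elim
    case (elim \<omega>)
    then have "summable (\<lambda>m. f (m + m0) \<omega>)" by (intro summable_suminf_not_top) (use nn in auto)
    then show ?case by (intro LIMSEQ_offset[OF summable_LIMSEQ_zero])
  qed
qed

text \<open>The power \<open>\<bar>Z\<bar> powr q\<close> dominates both pieces:
  \<open>T ^ 4\<close> where \<open>\<bar>Z\<bar> \<le> 1\<close>, because \<open>q \<le> 4\<close>,
  and \<open>\<bar>Z - T\<bar>\<close> where \<open>\<bar>Z\<bar> > 1\<close>, because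
  \<open>q \<ge> 1\<close>. Thus the single quantity \<open>h\<close> controls the fourth moment of
  the truncated part and the first moment of the remainder.\<close>

lemma truncated_moments:
  fixes Z :: "'a \<Rightarrow> real" and q :: real
  assumes q: "1 \<le> q" "q \<le> 4"
    and Z1: "integrable M Z" and Z2: "integrable M (\<lambda>\<omega>. (Z \<omega>)\<^sup>2)" and Zq: "integrable M (\<lambda>\<omega>. \<bar>Z \<omega>\<bar> powr q)"
    and Z0: "expectation Z = 0"
  defines "T \<equiv> \<lambda>\<omega>. if \<bar>Z \<omega>\<bar> \<le> 1 then Z \<omega> else 0"
  defines "h \<equiv> expectation (\<lambda>\<omega>. \<bar>Z \<omega>\<bar> powr q)" and "c \<equiv> expectation T"
  shows "integrable M T" and "integrable M (\<lambda>\<omega>. (T \<omega> - c) ^ 4)"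
    and "expectation (\<lambda>\<omega>. (T \<omega> - c)\<^sup>2) \<le> expectation (\<lambda>\<omega>. (Z \<omega>)\<^sup>2)"
    and "expectation (\<lambda>\<omega>. (T \<omega> - c) ^ 4) \<le> 16 * h"
    and "expectation (\<lambda>\<omega>. \<bar>Z \<omega> - T \<omega> + c\<bar>) \<le> 2 * h"
proof -
  have [measurable]: "Z \<in> borel_measurable M" using Z1 by auto
  have [measurable]: "T \<in> borel_measurable M" unfolding T_def by measurable
  have T1: "\<bar>T \<omega>\<bar> \<le> 1" for \<omega> by (simp add: T_def)
  show Ti: "integrable M T" by (rule integrable_const_bound[where B = 1]) (use T1 in auto)
  have T2: "integrable M (\<lambda>\<omega>. (T \<omega>)\<^sup>2)"
    by (rule integrable_const_bound[where B = 1]) (use T1 in \<open>auto simp: abs_square_le_1\<close>)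
  have T4: "integrable M (\<lambda>\<omega>. T \<omega> ^ 4)"
    by (rule integrable_const_bound[where B = 1]) (use power_le_one[OF abs_ge_zero T1, of _ 4] in auto)
  have c4: "integrable M (\<lambda>\<omega>. (- c) ^ 4)" by simp
  show W4: "integrable M (\<lambda>\<omega>. (T \<omega> - c) ^ 4)"
    using integrable_power4_bounds(3)[OF _ _ T4 c4] by simp
  have "expectation (\<lambda>\<omega>. (T \<omega> - c)\<^sup>2) = expectation (\<lambda>\<omega>. (T \<omega>)\<^sup>2) - c\<^sup>2"
    unfolding c_def by (rule variance_eq[OF Ti T2])
  also have "\<dots> \<le> expectation (\<lambda>\<omega>. (T \<omega>)\<^sup>2)" by simp
  also have "\<dots> \<le> expectation (\<lambda>\<omega>. (Z \<omega>)\<^sup>2)"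
    by (rule integral_mono[OF T2 Z2]) (auto simp: T_def)
  finally show "expectation (\<lambda>\<omega>. (T \<omega> - c)\<^sup>2) \<le> expectation (\<lambda>\<omega>. (Z \<omega>)\<^sup>2)" .
  have tail: "\<bar>Z \<omega> - T \<omega>\<bar> \<le> \<bar>Z \<omega>\<bar> powr q" for \<omega>
  proof (cases "\<bar>Z \<omega>\<bar> \<le> 1")
    case False
    then have "\<bar>Z \<omega>\<bar> powr 1 \<le> \<bar>Z \<omega>\<bar> powr q" using q by (intro powr_mono) auto
    then show ?thesis using False by (simp add: T_def)
  qed (simp add: T_def)
  have ZT: "expectation (\<lambda>\<omega>. \<bar>Z \<omega> - T \<omega>\<bar>) \<le> h"
    unfolding h_def by (rule integral_mono[OF _ Zq tail]) (use Z1 Ti in auto)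
  \<comment> \<open>Since \<open>Z\<close> is centred, the mean of \<open>T\<close> is minus the
    mean of the tail, so it inherits the bound \<open>h\<close>. With
    \<open>\<bar>c\<bar> \<le> 1\<close> this also bounds \<open>c ^ 4\<close>.\<close>
  have "c = - expectation (\<lambda>\<omega>. Z \<omega> - T \<omega>)" using Z0 Z1 Ti by (simp add: c_def)
  then have "\<bar>c\<bar> \<le> expectation (\<lambda>\<omega>. \<bar>Z \<omega> - T \<omega>\<bar>)" by (simp add: integral_abs_bound)
  then have ch: "\<bar>c\<bar> \<le> h" using ZT by linarith
  have "\<bar>c\<bar> \<le> expectation (\<lambda>\<omega>. \<bar>T \<omega>\<bar>)" unfolding c_def by (rule integral_abs_bound)
  also have "\<dots> \<le> expectation (\<lambda>\<omega>. 1)" by (rule integral_mono) (use Ti T1 in auto)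
  finally have c1: "\<bar>c\<bar> \<le> 1" by (simp add: prob_space)
  have "\<bar>c\<bar> ^ 4 \<le> \<bar>c\<bar> ^ 1" using c1 by (intro power_decreasing) auto
  then have c4h: "c ^ 4 \<le> h" using ch by simp
  have T4q: "T \<omega> ^ 4 \<le> \<bar>Z \<omega>\<bar> powr q" for \<omega>
  \<comment> \<open>The value 0 is set aside because \<open>powr\<close> is converted to a natural
    power at a positive base.\<close>
  proof (cases "\<bar>Z \<omega>\<bar> \<le> 1 \<and> Z \<omega> \<noteq> 0")
    case True
    then have "\<bar>Z \<omega>\<bar> powr real 4 \<le> \<bar>Z \<omega>\<bar> powr q" using q by (intro powr_mono') auto
    also have "\<bar>Z \<omega>\<bar> powr real 4 = \<bar>Z \<omega>\<bar> ^ 4" using True by (subst powr_realpow) auto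
    finally show ?thesis using True by (simp add: T_def)
  qed (auto simp: T_def)
  have "expectation (\<lambda>\<omega>. (T \<omega> - c) ^ 4) \<le> expectation (\<lambda>\<omega>. 8 * (T \<omega> ^ 4 + c ^ 4))"
    by (rule integral_mono[OF W4]) (use T4 power4_add_le_8[of "T _" "- c"] in auto)
  also have "\<dots> = 8 * (expectation (\<lambda>\<omega>. T \<omega> ^ 4) + c ^ 4)" using T4 by (simp add: prob_space)
  also have "expectation (\<lambda>\<omega>. T \<omega> ^ 4) \<le> h" unfolding h_def by (rule integral_mono[OF T4 Zq T4q])
  finally show "expectation (\<lambda>\<omega>. (T \<omega> - c) ^ 4) \<le> 16 * h" using c4h by simp
  have "expectation (\<lambda>\<omega>. \<bar>Z \<omega> - T \<omega> + c\<bar>) \<le> expectation (\<lambda>\<omega>. \<bar>Z \<omega> - T \<omega>\<bar> + \<bar>c\<bar>)"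
    by (rule integral_mono) (use Z1 Ti in auto)
  also have "\<dots> = expectation (\<lambda>\<omega>. \<bar>Z \<omega> - T \<omega>\<bar>) + \<bar>c\<bar>" using Z1 Ti by (simp add: prob_space)
  finally show "expectation (\<lambda>\<omega>. \<bar>Z \<omega> - T \<omega> + c\<bar>) \<le> 2 * h" using ZT ch by linarith
qed

text \<open>\<open>V\<close> sums the recentred truncations, which remain independent and centred,
  so the fourth moment bound applies. \<open>R\<close> collects the tails and the recentring
  constants and needs only the triangle inequality. The constant 48 is 3 times the 16 of a single
  term.\<close>

lemma truncation_decomposition:
  fixes Z :: "'i \<Rightarrow> 'a \<Rightarrow> real" and q :: real
  assumes F: "finite F" and ind: "indep_vars (\<lambda>_. borel) Z F" and q: "1 \<le> q" "q \<le> 4"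
    and Z1: "\<And>i. i \<in> F \<Longrightarrow> integrable M (Z i)"
    and Z2: "\<And>i. i \<in> F \<Longrightarrow> integrable M (\<lambda>\<omega>. (Z i \<omega>)\<^sup>2)"
    and Zq: "\<And>i. i \<in> F \<Longrightarrow> integrable M (\<lambda>\<omega>. \<bar>Z i \<omega>\<bar> powr q)"
    and Z0: "\<And>i. i \<in> F \<Longrightarrow> expectation (Z i) = 0"
  obtains V R :: "'a \<Rightarrow> real" where
    "\<And>\<omega>. (\<Sum>i\<in>F. Z i \<omega>) = V \<omega> + R \<omega>"
    "integrable M (\<lambda>\<omega>. V \<omega> ^ 4)" "integrable M R"
    "expectation (\<lambda>\<omega>. V \<omega> ^ 4) \<le> 4 * (\<Sum>i\<in>F. expectation (\<lambda>\<omega>. (Z i \<omega>)\<^sup>2))\<^sup>2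
        + 48 * (\<Sum>i\<in>F. expectation (\<lambda>\<omega>. \<bar>Z i \<omega>\<bar> powr q))"
    "expectation (\<lambda>\<omega>. \<bar>R \<omega>\<bar>) \<le> 2 * (\<Sum>i\<in>F. expectation (\<lambda>\<omega>. \<bar>Z i \<omega>\<bar> powr q))"
proof -
  define T where "T i \<omega> = (if \<bar>Z i \<omega>\<bar> \<le> 1 then Z i \<omega> else 0)" for i \<omega>
  define c where "c i = expectation (T i)" for i
  define V where "V \<omega> = (\<Sum>i\<in>F. T i \<omega> - c i)" for \<omega>
  define R where "R \<omega> = (\<Sum>i\<in>F. Z i \<omega> - T i \<omega> + c i)" for \<omega>
  have t: "integrable M (T i)" "integrable M (\<lambda>\<omega>. (T i \<omega> - c i) ^ 4)"
    "expectation (\<lambda>\<omega>. (T i \<omega> - c i)\<^sup>2) \<le> expectation (\<lambda>\<omega>. (Z i \<omega>)\<^sup>2)"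
    "expectation (\<lambda>\<omega>. (T i \<omega> - c i) ^ 4) \<le> 16 * expectation (\<lambda>\<omega>. \<bar>Z i \<omega>\<bar> powr q)"
    "expectation (\<lambda>\<omega>. \<bar>Z i \<omega> - T i \<omega> + c i\<bar>) \<le> 2 * expectation (\<lambda>\<omega>. \<bar>Z i \<omega>\<bar> powr q)"
    if "i \<in> F" for i
    using truncated_moments[OF q Z1 Z2 Zq Z0, OF that that that that] unfolding c_def T_def by auto
  have indW: "indep_vars (\<lambda>_. borel) (\<lambda>i \<omega>. T i \<omega> - c i) F"
    unfolding T_def by (rule indep_vars_compose2[OF ind, where Y = "\<lambda>i x. (if \<bar>x\<bar> \<le> 1 then x else 0) - c i"]) auto
  have W0: "expectation (\<lambda>\<omega>. T i \<omega> - c i) = 0" if "i \<in> F" for i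
    using t(1)[OF that] by (simp add: c_def prob_space)
  note W = fourth_moment_sum_indep[OF F indW t(2) W0, folded V_def]
  show thesis
  proof
    show "(\<Sum>i\<in>F. Z i \<omega>) = V \<omega> + R \<omega>" for \<omega>
      by (simp add: V_def R_def flip: sum.distrib)
    show "integrable M (\<lambda>\<omega>. V \<omega> ^ 4)" using W by simp
    show "integrable M R" unfolding R_def[abs_def] using t(1) Z1 by (intro Bochner_Integration.integrable_sum) auto
    have "expectation (\<lambda>\<omega>. V \<omega> ^ 4) \<le> 4 * (\<Sum>i\<in>F. expectation (\<lambda>\<omega>. (T i \<omega> - c i)\<^sup>2))\<^sup>2
       + 3 * (\<Sum>i\<in>F. expectation (\<lambda>\<omega>. (T i \<omega> - c i) ^ 4))" using W by simp
    also have "\<dots> \<le> 4 * (\<Sum>i\<in>F. expectation (\<lambda>\<omega>. (Z i \<omega>)\<^sup>2))\<^sup>2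
       + 3 * (\<Sum>i\<in>F. 16 * expectation (\<lambda>\<omega>. \<bar>Z i \<omega>\<bar> powr q))"
      by (intro add_mono mult_left_mono power_mono sum_mono sum_nonneg) (use t in auto)
    finally show "expectation (\<lambda>\<omega>. V \<omega> ^ 4) \<le> 4 * (\<Sum>i\<in>F. expectation (\<lambda>\<omega>. (Z i \<omega>)\<^sup>2))\<^sup>2
        + 48 * (\<Sum>i\<in>F. expectation (\<lambda>\<omega>. \<bar>Z i \<omega>\<bar> powr q))"
      by (simp add: sum_distrib_left mult.assoc)
    have "expectation (\<lambda>\<omega>. \<bar>R \<omega>\<bar>) \<le> expectation (\<lambda>\<omega>. \<Sum>i\<in>F. \<bar>Z i \<omega> - T i \<omega> + c i\<bar>)"
      unfolding R_def by (rule integral_mono) (use t(1) Z1 in \<open>auto intro!: Bochner_Integration.integrable_sum integrable_abs\<close>)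
    also have "\<dots> = (\<Sum>i\<in>F. expectation (\<lambda>\<omega>. \<bar>Z i \<omega> - T i \<omega> + c i\<bar>))"
      by (rule Bochner_Integration.integral_sum) (use t(1) Z1 in auto)
    also have "\<dots> \<le> (\<Sum>i\<in>F. 2 * expectation (\<lambda>\<omega>. \<bar>Z i \<omega>\<bar> powr q))"
      by (intro sum_mono) (use t in auto)
    finally show "expectation (\<lambda>\<omega>. \<bar>R \<omega>\<bar>) \<le> 2 * (\<Sum>i\<in>F. expectation (\<lambda>\<omega>. \<bar>Z i \<omega>\<bar> powr q))"
      by (simp add: sum_distrib_left)
  qed
qed

end

section \<open>Almost sure limits of linear and quadratic forms in row-wise i.i.d. arrays\<close>

lemma tendsto_zero_of_power4:
  fixes f :: "nat \<Rightarrow> real"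
  assumes "(\<lambda>m. f m ^ 4) \<longlonglongrightarrow> 0"
  shows "f \<longlonglongrightarrow> 0"
proof -
  have "root 4 (x ^ 4) = \<bar>x\<bar>" for x :: real
    using real_root_power_cancel[of 4 "\<bar>x\<bar>"] by simp
  then show ?thesis
    using tendsto_real_root[OF assms, of 4] by (simp add: tendsto_rabs_zero_iff)
qed

text \<open>A triangular array on one probability space: row \<open>m\<close> is i.i.d. with law
  \<open>\<mu>\<close>, and nothing relates different rows. The index sets are abstract so that a
  row can later consist of all entries of \<open>n\<close> matrices.\<close>

locale iid_array = prob_space M for M :: "'a measure" +
  fixes I :: "nat \<Rightarrow> 'i set" and X :: "nat \<Rightarrow> 'i \<Rightarrow> 'a \<Rightarrow> real" and \<mu> :: "real measure" and \<epsilon> :: real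
  assumes finite_I: "finite (I m)"
    and indep: "indep_vars (\<lambda>_. borel) (X m) (I m)"
    and distr: "s \<in> I m \<Longrightarrow> distr M borel (X m s) = \<mu>"
    and mean: "(\<integral>x. x \<partial>\<mu>) = 0" and var: "(\<integral>x. x\<^sup>2 \<partial>\<mu>) = 1"
    and eps_pos: "\<epsilon> > 0" and moment: "integrable \<mu> (\<lambda>x. \<bar>x\<bar> powr (4 + \<epsilon>))"
begin

definition m4 :: real where "m4 = (\<integral>x. x ^ 4 \<partial>\<mu>)"

text \<open>The cap at 2 keeps the exponent below 4, as the truncation argument requires.\<close>

definition q :: real where "q = 2 + min \<epsilon> 2 / 2"

definition mq :: real where "mq = (\<integral>x. \<bar>x\<^sup>2 - 1\<bar> powr q \<partial>\<mu>)"

lemma q_bounds: "2 < q" "q \<le> 4" "2 * q \<le> 4 + \<epsilon>"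
  using eps_pos by (auto simp: q_def min_def)

lemma m4_nonneg: "0 \<le> m4"
  by (simp add: m4_def)

context
  fixes m s
  assumes s: "s \<in> I m"
begin

lemma rv [measurable]: "X m s \<in> borel_measurable M"
  using indep s by (auto simp: indep_vars_def)

lemma expectation_eq: "f \<in> borel_measurable borel \<Longrightarrow> expectation (\<lambda>\<omega>. f (X m s \<omega>)) = (\<integral>x. f x \<partial>\<mu>)"
  for f :: "real \<Rightarrow> real"
  using integral_distr[of "X m s" M borel f] distr[OF s] by simp

lemma integrable_moment: "integrable M (\<lambda>\<omega>. \<bar>X m s \<omega>\<bar> powr (4 + \<epsilon>))"
  using integrable_distr_eq[of "X m s" M borel "\<lambda>x. \<bar>x\<bar> powr (4 + \<epsilon>)"] distr[OF s] moment by simp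

lemma integrable_power4: "integrable M (\<lambda>\<omega>. X m s \<omega> ^ 4)"
proof (rule Bochner_Integration.integrable_bound)
  show "integrable M (\<lambda>\<omega>. 1 + \<bar>X m s \<omega>\<bar> powr (4 + \<epsilon>))" using integrable_moment by simp
  have "x ^ 4 \<le> 1 + \<bar>x\<bar> powr (4 + \<epsilon>)" for x :: real
  proof (cases "\<bar>x\<bar> \<le> 1")
    case True
    then have "x ^ 4 \<le> 1" using power_le_one[of "\<bar>x\<bar>" 4] by simp
    then show ?thesis by (simp add: add_increasing2)
  next
    case False
    then have "x ^ 4 = \<bar>x\<bar> powr real 4" by (subst powr_realpow) auto
    also have "\<dots> \<le> \<bar>x\<bar> powr (4 + \<epsilon>)" using False eps_pos by (intro powr_mono) auto
    finally show ?thesis by simp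
  qed
  then show "AE \<omega> in M. norm (X m s \<omega> ^ 4) \<le> norm (1 + \<bar>X m s \<omega>\<bar> powr (4 + \<epsilon>))"
    by (simp add: add_nonneg_nonneg)
qed simp

lemma moments:
  "expectation (X m s) = 0" "expectation (\<lambda>\<omega>. (X m s \<omega>)\<^sup>2) = 1" "expectation (\<lambda>\<omega>. X m s \<omega> ^ 4) = m4"
  using expectation_eq[of "\<lambda>x. x"] expectation_eq[of "\<lambda>x. x\<^sup>2"] expectation_eq[of "\<lambda>x. x ^ 4"]
  by (simp_all add: mean var m4_def)

text \<open>Where \<open>\<bar>x\<bar> > 1\<close> the integrand is at most
  \<open>\<bar>x\<bar> powr (2 * q)\<close>, and \<open>2 * q \<le> 4 + \<epsilon>\<close>;
  elsewhere it is at most 1.\<close>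

lemma integrable_centered_square_powr: "integrable M (\<lambda>\<omega>. \<bar>(X m s \<omega>)\<^sup>2 - 1\<bar> powr q)"
proof (rule Bochner_Integration.integrable_bound)
  show "integrable M (\<lambda>\<omega>. 1 + \<bar>X m s \<omega>\<bar> powr (4 + \<epsilon>))" using integrable_moment by simp
  have "\<bar>x\<^sup>2 - 1\<bar> powr q \<le> 1 + \<bar>x\<bar> powr (4 + \<epsilon>)" for x :: real
  proof (cases "\<bar>x\<bar> \<le> 1")
    case True
    then have "\<bar>x\<^sup>2 - 1\<bar> \<le> 1" using abs_square_le_1[of x] by (simp add: abs_le_iff)
    then have "\<bar>x\<^sup>2 - 1\<bar> powr q \<le> 1" using q_bounds by (intro powr_le1) auto
    then show ?thesis by (simp add: add_increasing2)
  next
    case False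
    then have "1 \<le> x\<^sup>2" using abs_square_less_1[of x] by (simp add: not_less[symmetric])
    moreover have "\<bar>x\<bar> powr 2 = x\<^sup>2" using False powr_realpow[of "\<bar>x\<bar>" 2] by auto
    ultimately have "\<bar>x\<^sup>2 - 1\<bar> powr q \<le> (\<bar>x\<bar> powr 2) powr q"
      using q_bounds by (intro powr_mono2) auto
    also have "\<dots> = \<bar>x\<bar> powr (2 * q)" by (rule powr_powr)
    also have "\<dots> \<le> \<bar>x\<bar> powr (4 + \<epsilon>)" using False q_bounds by (intro powr_mono) auto
    finally show ?thesis by simp
  qed
  then show "AE \<omega> in M. norm (\<bar>(X m s \<omega>)\<^sup>2 - 1\<bar> powr q) \<le> norm (1 + \<bar>X m s \<omega>\<bar> powr (4 + \<epsilon>))"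
    by (simp add: add_nonneg_nonneg)
qed simp

lemma centered_square:
  "integrable M (\<lambda>\<omega>. (X m s \<omega>)\<^sup>2 - 1)" "integrable M (\<lambda>\<omega>. ((X m s \<omega>)\<^sup>2 - 1)\<^sup>2)"
  "expectation (\<lambda>\<omega>. (X m s \<omega>)\<^sup>2 - 1) = 0" "expectation (\<lambda>\<omega>. ((X m s \<omega>)\<^sup>2 - 1)\<^sup>2) = m4 - 1"
  "expectation (\<lambda>\<omega>. \<bar>(X m s \<omega>)\<^sup>2 - 1\<bar> powr q) = mq"
proof -
  note i = integrable_power4_imp(2)[OF rv integrable_power4] integrable_power4
  have eq: "(x\<^sup>2 - 1)\<^sup>2 = x ^ 4 - 2 * x\<^sup>2 + 1" for x :: real
    by (simp add: power2_diff flip: power_mult)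
  show "integrable M (\<lambda>\<omega>. (X m s \<omega>)\<^sup>2 - 1)" "integrable M (\<lambda>\<omega>. ((X m s \<omega>)\<^sup>2 - 1)\<^sup>2)"
    "expectation (\<lambda>\<omega>. (X m s \<omega>)\<^sup>2 - 1) = 0" "expectation (\<lambda>\<omega>. ((X m s \<omega>)\<^sup>2 - 1)\<^sup>2) = m4 - 1"
    unfolding eq using i moments by (simp_all add: prob_space)
  show "expectation (\<lambda>\<omega>. \<bar>(X m s \<omega>)\<^sup>2 - 1\<bar> powr q) = mq"
    unfolding mq_def by (rule expectation_eq) simp
qed

end

lemma summable_inverse_square: "summable (\<lambda>m. K * (C / real m)\<^sup>2)"
proof -
  have "summable (\<lambda>m. 1 / real m ^ 2)" 
    using inverse_power_summable[of 2, where 'a = real] by (simp add: field_simps)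
  then have "summable (\<lambda>m. K * C\<^sup>2 * (1 / real m ^ 2))" by (rule summable_mult)
  then show ?thesis by (simp add: power_divide)
qed

lemma AE_linear_forms_tendsto_zero:
  assumes a: "\<And>m. m \<ge> m0 \<Longrightarrow> (\<Sum>s\<in>I m. (a m s)\<^sup>2) \<le> C / real m"
  shows "AE \<omega> in M. (\<lambda>m. \<Sum>s\<in>I m. a m s * X m s \<omega>) \<longlonglongrightarrow> 0"
proof -
  note lin = fourth_moment_linear_form[OF finite_I indep m4_nonneg integrable_power4 moments(1,2) eq_refl[OF moments(3)]]
  have "AE \<omega> in M. (\<lambda>m. (\<Sum>s\<in>I m. a m s * X m s \<omega>) ^ 4) \<longlonglongrightarrow> 0"
  proof (rule AE_tendsto_zero_of_summable_expectation)
    show "summable (\<lambda>m. (4 + 3 * m4) * (C / real m)\<^sup>2)" by (rule summable_inverse_square)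
    show "expectation (\<lambda>\<omega>. (\<Sum>s\<in>I m. a m s * X m s \<omega>) ^ 4) \<le> (4 + 3 * m4) * (C / real m)\<^sup>2"
      if "m \<ge> m0" for m
    proof (rule order_trans[OF lin(2)])
      show "(4 + 3 * m4) * (\<Sum>i\<in>I m. (a m i)\<^sup>2)\<^sup>2 \<le> (4 + 3 * m4) * (C / real m)\<^sup>2"
        using a[OF that] m4_nonneg by (intro mult_left_mono power_mono sum_nonneg) auto
    qed
  qed (use lin(1) in auto)
  then show ?thesis by eventually_elim (rule tendsto_zero_of_power4)
qed

lemma AE_off_diagonal_forms_tendsto_zero:
  assumes b: "\<And>m. m \<ge> m0 \<Longrightarrow> (\<Sum>s\<in>I m. \<Sum>t\<in>I m. (b m s t)\<^sup>2) \<le> C / real m"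
  shows "AE \<omega> in M. (\<lambda>m. \<Sum>s\<in>I m. \<Sum>t\<in>I m - {s}. b m s t * (X m s \<omega> * X m t \<omega>)) \<longlonglongrightarrow> 0"
proof -
  note form = fourth_moment_off_diagonal_form[OF m4_nonneg finite_I indep integrable_power4 moments(1,2) eq_refl[OF moments(3)]]
  have "AE \<omega> in M. (\<lambda>m. (\<Sum>s\<in>I m. \<Sum>t\<in>I m - {s}. b m s t * (X m s \<omega> * X m t \<omega>)) ^ 4) \<longlonglongrightarrow> 0"
  proof (rule AE_tendsto_zero_of_summable_expectation)
    show "summable (\<lambda>m. (2 * (4 + 3 * m4)\<^sup>2)\<^sup>2 * (C / real m)\<^sup>2)" by (rule summable_inverse_square)
    show "expectation (\<lambda>\<omega>. (\<Sum>s\<in>I m. \<Sum>t\<in>I m - {s}. b m s t * (X m s \<omega> * X m t \<omega>)) ^ 4)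
        \<le> (2 * (4 + 3 * m4)\<^sup>2)\<^sup>2 * (C / real m)\<^sup>2" if "m \<ge> m0" for m
    proof (rule order_trans[OF form[THEN conjunct2]])
      have "(\<Sum>s\<in>I m. \<Sum>t\<in>I m - {s}. (b m s t)\<^sup>2) \<le> (\<Sum>s\<in>I m. \<Sum>t\<in>I m. (b m s t)\<^sup>2)"
        by (intro sum_mono sum_mono2 finite_I) auto
      also note b[OF that]
      finally show "(2 * (4 + 3 * m4)\<^sup>2 * (\<Sum>s\<in>I m. \<Sum>t\<in>I m - {s}. (b m s t)\<^sup>2))\<^sup>2
          \<le> (2 * (4 + 3 * m4)\<^sup>2)\<^sup>2 * (C / real m)\<^sup>2"
        unfolding power_mult_distrib[of "2 * (4 + 3 * m4)\<^sup>2"]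
        by (intro mult_left_mono power_mono sum_nonneg) auto
    qed
  qed (use form in auto)
  then show ?thesis by eventually_elim (rule tendsto_zero_of_power4)
qed

text \<open>Truncation with exponent \<open>q\<close>. Of the \<open>q\<close> powers of
  \<open>\<bar>d m s\<bar>\<close>, two are summed through \<open>d2\<close> and contribute
  \<open>C / real m\<close>, and the other \<open>q - 2\<close> are bounded uniformly through
  \<open>d\<close>. The resulting order \<open>(C / real m) powr (q - 1)\<close> is summable because
  \<open>q > 2\<close>.\<close>

lemma AE_diagonal_forms_tendsto_zero:
  assumes C: "C \<ge> 0" and d2: "\<And>m. m \<ge> m0 \<Longrightarrow> (\<Sum>s\<in>I m. (d m s)\<^sup>2) \<le> C / real m"
    and d: "\<And>m s. m \<ge> m0 \<Longrightarrow> s \<in> I m \<Longrightarrow> \<bar>d m s\<bar> \<le> C / real m"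
  shows "AE \<omega> in M. (\<lambda>m. \<Sum>s\<in>I m. d m s * ((X m s \<omega>)\<^sup>2 - 1)) \<longlonglongrightarrow> 0"
proof -
  define Z where "Z m s \<omega> = d m s * ((X m s \<omega>)\<^sup>2 - 1)" for m s \<omega>
  define h where "h m = (\<Sum>s\<in>I m. expectation (\<lambda>\<omega>. \<bar>Z m s \<omega>\<bar> powr q))" for m
  define v where "v m = (\<Sum>s\<in>I m. expectation (\<lambda>\<omega>. (Z m s \<omega>)\<^sup>2))" for m
  have indZ: "indep_vars (\<lambda>_. borel) (Z m) (I m)" for m
    unfolding Z_def[abs_def]
    by (rule indep_vars_compose2[OF indep, where Y = "\<lambda>s x. d m s * (x\<^sup>2 - 1)"]) auto
  have Z: "integrable M (Z m s)" "integrable M (\<lambda>\<omega>. (Z m s \<omega>)\<^sup>2)" "expectation (Z m s) = 0"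
    "expectation (\<lambda>\<omega>. (Z m s \<omega>)\<^sup>2) = (d m s)\<^sup>2 * (m4 - 1)"
    "integrable M (\<lambda>\<omega>. \<bar>Z m s \<omega>\<bar> powr q)" "expectation (\<lambda>\<omega>. \<bar>Z m s \<omega>\<bar> powr q) = \<bar>d m s\<bar> powr q * mq"
    if "s \<in> I m" for m s
    unfolding Z_def[abs_def] power_mult_distrib abs_mult powr_mult
    using centered_square[OF that] integrable_centered_square_powr[OF that] by simp_all
  have q: "1 \<le> q" "q \<le> 4" using q_bounds by auto
  have "\<exists>V R. (\<forall>\<omega>. (\<Sum>s\<in>I m. Z m s \<omega>) = V \<omega> + R \<omega>) \<and> integrable M (\<lambda>\<omega>. V \<omega> ^ 4) \<and> integrable M R
      \<and> expectation (\<lambda>\<omega>. V \<omega> ^ 4) \<le> 4 * (v m)\<^sup>2 + 48 * h m \<and> expectation (\<lambda>\<omega>. \<bar>R \<omega>\<bar>) \<le> 2 * h m" for m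
    by (rule truncation_decomposition[OF finite_I indZ q Z(1,2,5,3), of m]) (auto simp: v_def h_def)
  then obtain V R where sum_Z: "\<And>m \<omega>. (\<Sum>s\<in>I m. Z m s \<omega>) = V m \<omega> + R m \<omega>"
    and V4: "\<And>m. integrable M (\<lambda>\<omega>. V m \<omega> ^ 4)" and R1: "\<And>m. integrable M (R m)"
    and V4_le: "\<And>m. expectation (\<lambda>\<omega>. V m \<omega> ^ 4) \<le> 4 * (v m)\<^sup>2 + 48 * h m"
    and R_le: "\<And>m. expectation (\<lambda>\<omega>. \<bar>R m \<omega>\<bar>) \<le> 2 * h m"
    by metis
  have mq: "0 \<le> mq" by (simp add: mq_def)
  define H where "H m = mq * (C / real m) powr (q - 1)" for m
  have h_le: "h m \<le> H m" if m: "m \<ge> m0" for m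
  proof -
    have "\<bar>d m s\<bar> powr q \<le> (d m s)\<^sup>2 * (C / real m) powr (q - 2)" if "s \<in> I m" for s
    proof (cases "d m s = 0")
      case False
      have "\<bar>d m s\<bar> powr q = \<bar>d m s\<bar> powr (real 2 + (q - 2))" by simp
      also have "\<dots> = (d m s)\<^sup>2 * \<bar>d m s\<bar> powr (q - 2)"
        unfolding powr_add using False by (subst powr_realpow) auto
      also have "\<dots> \<le> (d m s)\<^sup>2 * (C / real m) powr (q - 2)"
        using d[OF m that] q_bounds by (intro mult_left_mono powr_mono2) auto
      finally show ?thesis .
    qed simp
    then have "h m \<le> (\<Sum>s\<in>I m. (d m s)\<^sup>2 * (C / real m) powr (q - 2) * mq)"
      unfolding h_def using Z(6) mq by (auto intro!: sum_mono mult_right_mono)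
    also have "\<dots> = (\<Sum>s\<in>I m. (d m s)\<^sup>2) * (C / real m) powr (q - 2) * mq"
      by (simp add: sum_distrib_right)
    also have "\<dots> \<le> (C / real m) * (C / real m) powr (q - 2) * mq"
      using d2[OF m] mq by (intro mult_right_mono) auto
    \<comment> \<open>The base vanishes when \<open>C = 0\<close> or \<open>m = 0\<close>; both
      sides are then 0.\<close>
    also have "\<dots> = H m"
    proof (cases "C / real m = 0")
      case False
      moreover have "C / real m \<ge> 0" using C by simp
      ultimately have pos: "C / real m > 0" by linarith
      have "(C / real m) powr (q - 1) = (C / real m) powr (1 + (q - 2))" by simp
      also have "\<dots> = (C / real m) * (C / real m) powr (q - 2)"
        unfolding powr_add using pos by (subst powr_one) auto
      finally show ?thesis by (simp add: H_def)
    next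
      case True
      show ?thesis unfolding H_def True by simp
    qed
    finally show ?thesis .
  qed
  have v_le: "(v m)\<^sup>2 \<le> (m4 - 1)\<^sup>2 * (C / real m)\<^sup>2" if m: "m \<ge> m0" for m
  proof -
    have "v m = (m4 - 1) * (\<Sum>s\<in>I m. (d m s)\<^sup>2)"
      unfolding v_def sum_distrib_left by (rule sum.cong) (simp_all add: Z(4))
    then show ?thesis
      using d2[OF m] by (auto simp: power_mult_distrib intro!: mult_left_mono power_mono sum_nonneg)
  qed
  have H: "summable H"
  proof -
    have "summable (\<lambda>m. mq * C powr (q - 1) * real m powr (- (q - 1)))"
      by (rule summable_mult) (use q_bounds summable_real_powr_iff in auto)
    moreover have "H m = mq * C powr (q - 1) * real m powr (- (q - 1))" for m
      unfolding H_def powr_minus using C by (subst powr_divide) (simp_all add: divide_inverse)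
    ultimately show ?thesis by presburger
  qed
  have "AE \<omega> in M. (\<lambda>m. V m \<omega> ^ 4) \<longlonglongrightarrow> 0"
  proof (rule AE_tendsto_zero_of_summable_expectation)
    show "summable (\<lambda>m. 4 * (m4 - 1)\<^sup>2 * (C / real m)\<^sup>2 + 48 * H m)"
      by (intro summable_add summable_inverse_square summable_mult H)
    show "expectation (\<lambda>\<omega>. V m \<omega> ^ 4) \<le> 4 * (m4 - 1)\<^sup>2 * (C / real m)\<^sup>2 + 48 * H m" if "m \<ge> m0" for m
      using V4_le[of m] v_le[OF that] h_le[OF that] by linarith
  qed (use V4 in auto)
  moreover have "AE \<omega> in M. (\<lambda>m. \<bar>R m \<omega>\<bar>) \<longlonglongrightarrow> 0"
  proof (rule AE_tendsto_zero_of_summable_expectation)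
    show "summable (\<lambda>m. 2 * H m)" by (intro summable_mult H)
    show "expectation (\<lambda>\<omega>. \<bar>R m \<omega>\<bar>) \<le> 2 * H m" if "m \<ge> m0" for m
      using R_le[of m] h_le[OF that] by linarith
  qed (use R1 in auto)
  ultimately show ?thesis
  proof eventually_elim
    case (elim \<omega>)
    have "(\<lambda>m. V m \<omega> + R m \<omega>) \<longlonglongrightarrow> 0"
      by (rule tendsto_add_zero[OF tendsto_zero_of_power4[OF elim(1)]])
         (use elim(2) in \<open>simp add: tendsto_rabs_zero_iff\<close>)
    then show ?case unfolding sum_Z[symmetric] by (simp add: Z_def)
  qed
qed

text \<open>By unit variance, subtracting the sum of the diagonal coefficients replaces each
  diagonal square by the centred variable \<open>(X m s \<omega>)\<^sup>2 - 1\<close>. The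
  off-diagonal products are centred already.\<close>

lemma AE_centered_quadratic_forms_tendsto_zero:
  assumes C: "C \<ge> 0" and b2: "\<And>m. m \<ge> m0 \<Longrightarrow> (\<Sum>s\<in>I m. \<Sum>t\<in>I m. (b m s t)\<^sup>2) \<le> C / real m"
    and b: "\<And>m s. m \<ge> m0 \<Longrightarrow> s \<in> I m \<Longrightarrow> \<bar>b m s s\<bar> \<le> C / real m"
  shows "AE \<omega> in M. (\<lambda>m. (\<Sum>s\<in>I m. \<Sum>t\<in>I m. b m s t * (X m s \<omega> * X m t \<omega>)) - (\<Sum>s\<in>I m. b m s s)) \<longlonglongrightarrow> 0"
proof -
  have d2: "(\<Sum>s\<in>I m. (b m s s)\<^sup>2) \<le> C / real m" if "m \<ge> m0" for m
  proof -
    have "(\<Sum>s\<in>I m. (b m s s)\<^sup>2) \<le> (\<Sum>s\<in>I m. \<Sum>t\<in>I m. (b m s t)\<^sup>2)"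
      by (intro sum_mono member_le_sum finite_I) auto
    then show ?thesis using b2[OF that] by linarith
  qed
  have split: "(\<Sum>s\<in>I m. \<Sum>t\<in>I m. b m s t * (X m s \<omega> * X m t \<omega>)) - (\<Sum>s\<in>I m. b m s s)
    = (\<Sum>s\<in>I m. \<Sum>t\<in>I m - {s}. b m s t * (X m s \<omega> * X m t \<omega>)) + (\<Sum>s\<in>I m. b m s s * ((X m s \<omega>)\<^sup>2 - 1))" for m \<omega>
  proof -
    have "(\<Sum>s\<in>I m. \<Sum>t\<in>I m. b m s t * (X m s \<omega> * X m t \<omega>))
      = (\<Sum>s\<in>I m. b m s s * (X m s \<omega>)\<^sup>2 + (\<Sum>t\<in>I m - {s}. b m s t * (X m s \<omega> * X m t \<omega>)))"
      by (intro sum.cong refl, subst sum.remove[OF finite_I]) (auto simp: power2_eq_square)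
    then show ?thesis by (simp add: sum.distrib sum_subtractf algebra_simps)
  qed
  have "AE \<omega> in M. (\<lambda>m. \<Sum>s\<in>I m. \<Sum>t\<in>I m - {s}. b m s t * (X m s \<omega> * X m t \<omega>)) \<longlonglongrightarrow> 0"
    by (rule AE_off_diagonal_forms_tendsto_zero) (rule b2)
  moreover have "AE \<omega> in M. (\<lambda>m. \<Sum>s\<in>I m. b m s s * ((X m s \<omega>)\<^sup>2 - 1)) \<longlonglongrightarrow> 0"
    by (rule AE_diagonal_forms_tendsto_zero[OF C]) (fact d2 b)+
  ultimately show ?thesis unfolding split by eventually_elim (rule tendsto_add_zero)
qed

end

section \<open>The normalised noise traces as forms in the matrix entries\<close>

definition entry_indices :: "nat \<Rightarrow> nat \<Rightarrow> nat \<Rightarrow> (nat \<times> nat \<times> nat) set" where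
  "entry_indices n m p = {1..n} \<times> {..<m} \<times> {..<p}"

text \<open>A noise array \<open>x\<close> lists the entries of \<open>E\<^sup>1, \<dots>, E\<^sup>n\<close> by triples (copy, row, column);
  \<open>mean_noise\<close> is then the matrix \<open>\<Sigma>\<^sup>1\<^sup>/\<^sup>2 (E\<^sup>1 + \<dots> + E\<^sup>n) / n\<close>.\<close>

definition mean_noise :: "nat \<Rightarrow> nat \<Rightarrow> (nat \<Rightarrow> nat \<Rightarrow> real) \<Rightarrow> (nat \<times> nat \<times> nat \<Rightarrow> real) \<Rightarrow> nat \<Rightarrow> nat \<Rightarrow> real" where
  "mean_noise n m R x i j = (1 / real n) * (\<Sum>k\<in>{1..n}. mprod m R (\<lambda>l j. x (k, l, j)) i j)"

text \<open>Up to normalisation, entry (l, j) of the transpose of \<open>R\<close> times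
  \<open>G\<close>. The copy \<open>k\<close> does not matter, all copies having equal weight in the
  average.\<close>

definition lin_coeff :: "nat \<Rightarrow> nat \<Rightarrow> nat \<Rightarrow> (nat \<Rightarrow> nat \<Rightarrow> real) \<Rightarrow> (nat \<Rightarrow> nat \<Rightarrow> real) \<Rightarrow> nat \<times> nat \<times> nat \<Rightarrow> real" where
  "lin_coeff n m p R G = (\<lambda>(k, l, j). (\<Sum>i<m. R i l * G i j) / (real n * (real m * real p)))"

text \<open>Left multiplication by the root acts on each column separately, so different columns do
  not interact. Within a column the kernel is \<open>S\<close>, the same for every pair of
  copies.\<close>

definition quad_coeff :: "nat \<Rightarrow> nat \<Rightarrow> nat \<Rightarrow> (nat \<Rightarrow> nat \<Rightarrow> real) \<Rightarrow> nat \<times> nat \<times> nat \<Rightarrow> nat \<times> nat \<times> nat \<Rightarrow> real" where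
  "quad_coeff n m p S = (\<lambda>(k, l, j) (k', l', j').
     if j = j' then S l l' / ((real n)\<^sup>2 * (real m * real p)) else 0)"

lemma finite_entry_indices: "finite (entry_indices n m p)"
  by (simp add: entry_indices_def)

lemma sum_entry_indices:
  "(\<Sum>s\<in>entry_indices n m p. f s) = (\<Sum>k\<in>{1..n}. \<Sum>l<m. \<Sum>j<p. f (k, l, j))"
  by (simp add: entry_indices_def sum.cartesian_product')

lemma tr_mean_noise_linear:
  "tr_mult_transp m p (mean_noise n m R x) G / (real m * real p)
    = (\<Sum>s\<in>entry_indices n m p. lin_coeff n m p R G s * x s)"
proof -
  define f where "f i j k l = R i l * x (k, l, j) * G i j / (real n * (real m * real p))" for i j k l
  have swap: "(\<Sum>i\<in>A. \<Sum>j\<in>J. \<Sum>k\<in>K. \<Sum>l\<in>L. f i j k l) = (\<Sum>k\<in>K. \<Sum>l\<in>L. \<Sum>j\<in>J. \<Sum>i\<in>A. f i j k l)"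
    for A J K L
    by (simp only: sum.swap[of _ J K] sum.swap[of _ J L] sum.swap[of _ A K] sum.swap[of _ A L] sum.swap[of _ A J])
  have "tr_mult_transp m p (mean_noise n m R x) G / (real m * real p)
      = (\<Sum>i<m. \<Sum>j<p. \<Sum>k\<in>{1..n}. \<Sum>l<m. f i j k l)"
    unfolding tr_mult_transp_def mean_noise_def mprod_def f_def sum_divide_distrib sum_distrib_left sum_distrib_right
    by (intro sum.cong refl) simp
  also have "\<dots> = (\<Sum>k\<in>{1..n}. \<Sum>l<m. \<Sum>j<p. \<Sum>i<m. f i j k l)" by (rule swap)
  also have "\<dots> = (\<Sum>s\<in>entry_indices n m p. lin_coeff n m p R G s * x s)"
    unfolding sum_entry_indices lin_coeff_def f_def prod.case sum_divide_distrib sum_distrib_right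
    by (intro sum.cong refl) simp
  finally show ?thesis .
qed

section \<open>Gram structure of the covariance and coefficient bounds from the traces\<close>

locale matrix_root =
  fixes m :: nat and R S :: "nat \<Rightarrow> nat \<Rightarrow> real"
  assumes R_sym: "\<And>i j. i < m \<Longrightarrow> j < m \<Longrightarrow> R i j = R j i"
    and R_sq: "\<And>i j. i < m \<Longrightarrow> j < m \<Longrightarrow> mprod m R R i j = S i j"
begin

text \<open>Symmetry of \<open>R\<close> turns its square into the Gram matrix of its columns; the
  estimates on \<open>S\<close> below rest on this.\<close>

lemma S_eq: "l < m \<Longrightarrow> l' < m \<Longrightarrow> S l l' = (\<Sum>i<m. R i l * R i l')"
  using R_sq[of l l'] R_sym by (auto simp: mprod_def intro!: sum.cong)

lemma S_diag: "l < m \<Longrightarrow> S l l = (\<Sum>i<m. (R i l)\<^sup>2)"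
  by (simp add: S_eq power2_eq_square)

lemma S_diag_nonneg: "l < m \<Longrightarrow> 0 \<le> S l l"
  by (simp add: S_diag sum_nonneg)

lemma S_square_le: "l < m \<Longrightarrow> l' < m \<Longrightarrow> (S l l')\<^sup>2 \<le> S l l * S l' l'"
  unfolding S_diag S_eq[of l l'] by (rule Cauchy_Schwarz_ineq_sum)

lemma S_diag_le: "l < m \<Longrightarrow> S l l \<le> mtrace m S"
  unfolding mtrace_def by (rule member_le_sum) (auto intro: S_diag_nonneg)

lemma trace_nonneg: "0 \<le> mtrace m S"
  unfolding mtrace_def by (rule sum_nonneg) (auto intro: S_diag_nonneg)

text \<open>Applied to each column of the averaged noise, this eliminates the root in favour of the
  covariance.\<close>

lemma sum_root_mult_square: "(\<Sum>i<m. (\<Sum>l<m. R i l * y l)\<^sup>2) = (\<Sum>l<m. \<Sum>l'<m. S l l' * (y l * y l'))"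
proof -
  have swap: "(\<Sum>i\<in>A. \<Sum>l\<in>L. \<Sum>l'\<in>L'. f i l l') = (\<Sum>l\<in>L. \<Sum>l'\<in>L'. \<Sum>i\<in>A. f i l l')"
    for A L L' :: "nat set" and f :: "nat \<Rightarrow> nat \<Rightarrow> nat \<Rightarrow> real"
    by (simp only: sum.swap[of _ A L] sum.swap[of _ A L'])
  have "(\<Sum>i<m. (\<Sum>l<m. R i l * y l)\<^sup>2) = (\<Sum>i<m. \<Sum>l<m. \<Sum>l'<m. (R i l * R i l') * (y l * y l'))"
    unfolding power2_eq_square sum_product by (intro sum.cong refl) simp
  also have "\<dots> = (\<Sum>l<m. \<Sum>l'<m. \<Sum>i<m. (R i l * R i l') * (y l * y l'))" by (rule swap)
  also have "\<dots> = (\<Sum>l<m. \<Sum>l'<m. S l l' * (y l * y l'))"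
    by (intro sum.cong refl) (simp add: S_eq sum_distrib_right)
  finally show ?thesis .
qed

lemma tr_mean_noise_quadratic:
  "tr_mult_transp m p (mean_noise n m R x) (mean_noise n m R x) / (real m * real p)
    = (\<Sum>s\<in>entry_indices n m p. \<Sum>t\<in>entry_indices n m p. quad_coeff n m p S s t * (x s * x t))"
proof -
  define g where "g j k l k' l' = S l l' / ((real n)\<^sup>2 * (real m * real p)) * (x (k, l, j) * x (k', l', j))" for j k l k' l'
  have swap1: "(\<Sum>l\<in>L. \<Sum>l'\<in>L'. \<Sum>k\<in>K. \<Sum>k'\<in>K'. f l l' k k') = (\<Sum>k\<in>K. \<Sum>l\<in>L. \<Sum>k'\<in>K'. \<Sum>l'\<in>L'. f l l' k k')"
    for K K' L L' :: "nat set" and f :: "nat \<Rightarrow> nat \<Rightarrow> nat \<Rightarrow> nat \<Rightarrow> real"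
    by (simp only: sum.swap[of _ L' K] sum.swap[of _ L K] sum.swap[of _ L' K'])
  have swap2: "(\<Sum>j\<in>J. \<Sum>k\<in>K. \<Sum>l\<in>L. f j k l) = (\<Sum>k\<in>K. \<Sum>l\<in>L. \<Sum>j\<in>J. f j k l)"
    for K J L :: "nat set" and f :: "nat \<Rightarrow> nat \<Rightarrow> nat \<Rightarrow> real"
    by (simp only: sum.swap[of _ J K] sum.swap[of _ J L])
  have col: "(\<Sum>i<m. mean_noise n m R x i j * mean_noise n m R x i j) / (real m * real p)
      = (\<Sum>k\<in>{1..n}. \<Sum>l<m. \<Sum>k'\<in>{1..n}. \<Sum>l'<m. g j k l k' l')" for j
  proof -
    \<comment> \<open>Column \<open>j\<close> of the average of the raw noise matrices; the root
      maps it to column \<open>j\<close> of \<open>mean_noise\<close>.\<close>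
    define y where "y l = (1 / real n) * (\<Sum>k\<in>{1..n}. x (k, l, j))" for l
    have "mean_noise n m R x i j = (\<Sum>l<m. R i l * y l)" for i
      unfolding mean_noise_def mprod_def y_def sum_distrib_left
      by (subst sum.swap, intro sum.cong refl) simp
    then have "(\<Sum>i<m. mean_noise n m R x i j * mean_noise n m R x i j) / (real m * real p)
        = (\<Sum>l<m. \<Sum>l'<m. S l l' * (y l * y l')) / (real m * real p)"
      using sum_root_mult_square[of y] by (simp add: power2_eq_square)
    also have "\<dots> = (\<Sum>l<m. \<Sum>l'<m. \<Sum>k\<in>{1..n}. \<Sum>k'\<in>{1..n}. g j k l k' l')"
      unfolding sum_divide_distrib
    proof (intro sum.cong refl)
      fix l l'
      have "y l * y l' = (\<Sum>k\<in>{1..n}. \<Sum>k'\<in>{1..n}. x (k, l, j) * x (k', l', j)) / (real n)\<^sup>2"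
        by (simp add: y_def sum_product power2_eq_square)
      then show "S l l' * (y l * y l') / (real m * real p) = (\<Sum>k\<in>{1..n}. \<Sum>k'\<in>{1..n}. g j k l k' l')"
        unfolding g_def sum_distrib_left[symmetric] by simp
    qed
    also have "\<dots> = (\<Sum>k\<in>{1..n}. \<Sum>l<m. \<Sum>k'\<in>{1..n}. \<Sum>l'<m. g j k l k' l')" by (rule swap1)
    finally show ?thesis .
  qed
  have "tr_mult_transp m p (mean_noise n m R x) (mean_noise n m R x) / (real m * real p)
      = (\<Sum>j<p. (\<Sum>i<m. mean_noise n m R x i j * mean_noise n m R x i j) / (real m * real p))"
    unfolding tr_mult_transp_def by (subst sum.swap) (simp only: sum_divide_distrib)
  also have "\<dots> = (\<Sum>k\<in>{1..n}. \<Sum>l<m. \<Sum>j<p. \<Sum>k'\<in>{1..n}. \<Sum>l'<m. g j k l k' l')"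
    unfolding col by (rule swap2)
  also have "\<dots> = (\<Sum>s\<in>entry_indices n m p. \<Sum>t\<in>entry_indices n m p. quad_coeff n m p S s t * (x s * x t))"
    unfolding sum_entry_indices quad_coeff_def prod.case g_def
  proof (intro sum.cong refl)
    \<comment> \<open>The column condition in \<open>quad_coeff\<close> collapses the sum over
      \<open>j'\<close> to the single index \<open>j\<close>, which is in range.\<close>
    fix k l j k' l' assume "j \<in> {..<p}"
    then show "S l l' / ((real n)\<^sup>2 * (real m * real p)) * (x (k, l, j) * x (k', l', j))
      = (\<Sum>j'<p. (if j = j' then S l l' / ((real n)\<^sup>2 * (real m * real p)) else 0) * (x (k, l, j) * x (k', l', j')))"
      by (simp add: if_distrib[of "\<lambda>c. c * _"] cong: if_cong)
  qed
  finally show ?thesis .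
qed

text \<open>Each \<open>S l l\<close> occurs once for every copy and column, so a factor
  \<open>n * p\<close> reduces the normalisation to \<open>n * m\<close>. This is the centring term
  of the third limit.\<close>

lemma sum_quad_coeff_diagonal:
  assumes "n > 0" "p > 0"
  shows "(\<Sum>s\<in>entry_indices n m p. quad_coeff n m p S s s) = mtrace m S / (real n * real m)"
  using assms
  by (simp add: sum_entry_indices quad_coeff_def mtrace_def power2_eq_square flip: sum_divide_distrib sum_distrib_left)

context
  fixes B :: real and n p :: nat
  assumes B: "mtrace m S \<le> B * real m" and n: "n > 0" and p: "p > 0" and m: "m > 0"
begin

text \<open>Cauchy-Schwarz over the rows bounds each squared numerator by \<open>S l l\<close> times
  the squared norm of column \<open>j\<close> of \<open>G\<close>, so the double sum is at most the
  product of the two traces. Summing over copies costs a factor \<open>n\<close> against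
  \<open>n\<^sup>2\<close> in the normalisation.\<close>

lemma sum_lin_coeff_square_le:
  assumes G: "tr_mult_transp m p G G \<le> B' * (real m * real p)"
  shows "(\<Sum>s\<in>entry_indices n m p. (lin_coeff n m p R G s)\<^sup>2) \<le> B * B' / real p"
proof -
  let ?N = "(real n * (real m * real p))\<^sup>2"
  have "(\<Sum>s\<in>entry_indices n m p. (lin_coeff n m p R G s)\<^sup>2)
     = real n * ((\<Sum>l<m. \<Sum>j<p. (\<Sum>i<m. R i l * G i j)\<^sup>2) / ?N)"
    by (simp add: sum_entry_indices lin_coeff_def power_divide flip: sum_divide_distrib)
  also have "\<dots> \<le> real n * ((\<Sum>l<m. \<Sum>j<p. S l l * (\<Sum>i<m. (G i j)\<^sup>2)) / ?N)"
    by (intro mult_left_mono divide_right_mono sum_mono) (auto simp: S_diag Cauchy_Schwarz_ineq_sum)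
  also have "(\<Sum>l<m. \<Sum>j<p. S l l * (\<Sum>i<m. (G i j)\<^sup>2)) = mtrace m S * tr_mult_transp m p G G"
    unfolding mtrace_def tr_mult_transp_def
    by (subst (2) sum.swap) (simp add: sum_product power2_eq_square)
  also have "real n * (mtrace m S * tr_mult_transp m p G G / ?N) \<le> real n * (B * real m * (B' * (real m * real p)) / ?N)"
  proof (intro mult_left_mono divide_right_mono mult_mono)
    show "0 \<le> B * real m" using B trace_nonneg by linarith
    show "0 \<le> tr_mult_transp m p G G" by (auto simp: tr_mult_transp_def intro!: sum_nonneg)
  qed (use B G in auto)
  also have "\<dots> = B * B' / (real n * real p)" using n m p by (simp add: power2_eq_square field_simps)
  \<comment> \<open>Dropping \<open>n\<close> from the denominator needs
    \<open>0 \<le> B * B'\<close>; both signs follow from nonnegative traces lying below the assumed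
    bounds.\<close>
  also have "\<dots> \<le> B * B' / real p"
  proof (intro divide_left_mono)
    have "0 \<le> B * real m" using B trace_nonneg by linarith
    then have "0 \<le> B" using m by (simp add: zero_le_mult_iff)
    moreover have "0 \<le> tr_mult_transp m p G G" by (auto simp: tr_mult_transp_def intro!: sum_nonneg)
    then have "0 \<le> B' * (real m * real p)" using G by linarith
    then have "0 \<le> B'" using m p by (subst (asm) zero_le_mult_iff) (auto simp: mult_le_0_iff)
    ultimately show "0 \<le> B * B'" by simp
  qed (use n p in auto)
  finally show ?thesis .
qed

text \<open>The entrywise bound \<open>(S l l')\<^sup>2 \<le> S l l * S l' l'\<close> sums to the
  squared trace. There are \<open>n\<^sup>2\<close> pairs of copies but only \<open>p\<close> pairs
  of equal columns, which leaves one factor \<open>p\<close> in the denominator.\<close>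

lemma sum_quad_coeff_square_le:
  "(\<Sum>s\<in>entry_indices n m p. \<Sum>t\<in>entry_indices n m p. (quad_coeff n m p S s t)\<^sup>2) \<le> B\<^sup>2 / real p"
proof -
  let ?N = "((real n)\<^sup>2 * (real m * real p))\<^sup>2"
  have "(\<Sum>s\<in>entry_indices n m p. \<Sum>t\<in>entry_indices n m p. (quad_coeff n m p S s t)\<^sup>2)
      = (\<Sum>k\<in>{1..n}. \<Sum>l<m. \<Sum>j<p. \<Sum>k'\<in>{1..n}. \<Sum>l'<m. (S l l')\<^sup>2 / ?N)"
    unfolding sum_entry_indices quad_coeff_def prod.case
    by (intro sum.cong refl) (simp add: if_distrib[of "\<lambda>c. c\<^sup>2"] power_divide cong: if_cong)
  also have "\<dots> \<le> (\<Sum>k\<in>{1..n}. \<Sum>l<m. \<Sum>j<p. \<Sum>k'\<in>{1..n}. \<Sum>l'<m. S l l * S l' l' / ?N)"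
    by (intro sum_mono divide_right_mono S_square_le) auto
  also have "\<dots> = (real n)\<^sup>2 * real p * ((mtrace m S)\<^sup>2 / ?N)"
    unfolding mtrace_def power2_eq_square[of "sum _ _"] sum_product
    by (simp add: power2_eq_square flip: sum_divide_distrib sum_distrib_left)
  also have "\<dots> \<le> (real n)\<^sup>2 * real p * ((B * real m)\<^sup>2 / ?N)"
    using B trace_nonneg by (intro mult_left_mono divide_right_mono power_mono) auto
  also have "\<dots> = B\<^sup>2 / real p / (real n)\<^sup>2" using n m p by (simp add: power2_eq_square field_simps)
  also have "\<dots> \<le> B\<^sup>2 / real p / 1" using n by (intro divide_left_mono) auto
  finally show ?thesis by simp
qed

text \<open>The diagonal of a Gram matrix is nonnegative, so a single entry is at most the
  trace.\<close>

lemma abs_quad_coeff_diagonal_le: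
  assumes "s \<in> entry_indices n m p"
  shows "\<bar>quad_coeff n m p S s s\<bar> \<le> B / real p"
proof -
  obtain k l j where s: "s = (k, l, j)" by (cases s)
  have l: "l < m" using assms by (auto simp: s entry_indices_def)
  have "\<bar>quad_coeff n m p S s s\<bar> = S l l / ((real n)\<^sup>2 * (real m * real p))"
    using S_diag_nonneg[OF l] by (simp add: s quad_coeff_def)
  also have "\<dots> \<le> (B * real m) / (1 * (real m * real p))"
    using S_diag_le[OF l] B S_diag_nonneg[OF l] n m p by (intro frac_le mult_right_mono) auto
  finally show ?thesis using m by simp
qed

end

end

section \<open>Application to the noise matrices and assembly of the three limits\<close>

theorem theorem3:
  fixes M :: "'w measure"
    and p :: "nat \<Rightarrow> nat" and c :: real and n :: nat
    and A :: "nat \<Rightarrow> nat \<Rightarrow> nat \<Rightarrow> real"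
    and Sigma :: "nat \<Rightarrow> nat \<Rightarrow> nat \<Rightarrow> real"
    and Sroot :: "nat \<Rightarrow> nat \<Rightarrow> nat \<Rightarrow> real"
    and E :: "nat \<Rightarrow> nat \<Rightarrow> 'w \<Rightarrow> nat \<Rightarrow> nat \<Rightarrow> real"
    and \<mu> :: "real measure"
  assumes P: "prob_space M"
    and c_pos: "c > 0"
    and ratio: "(\<lambda>m. real m / real (p m)) \<longlonglongrightarrow> c"
    and A_nonneg: "\<And>m i j. i < m \<Longrightarrow> j < p m \<Longrightarrow> A m i j \<ge> 0"
    and A_bdd: "\<exists>B. \<forall>m. tr_mult_transp m (p m) (A m) (A m) / (real m * real (p m)) \<le> B"
    and Sigma_pd: "\<And>m. sym_pos_def m (Sigma m)"
    and Sigma_bdd: "\<exists>B. \<forall>m. mtrace m (Sigma m) / real m \<le> B"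
    and Sroot_pd: "\<And>m. sym_pos_def m (Sroot m)"
    and Sroot_sq: "\<And>m i j. i < m \<Longrightarrow> j < m \<Longrightarrow> mprod m (Sroot m) (Sroot m) i j = Sigma m i j"
    and n_gt: "n > 1"
    and E_meas: "\<And>m k i j. k \<in> {1..n} \<Longrightarrow> i < m \<Longrightarrow> j < p m \<Longrightarrow>
                   (\<lambda>\<omega>. E m k \<omega> i j) \<in> borel_measurable M"
    and E_indep: "\<And>m. prob_space.indep_vars M (\<lambda>_. borel) (\<lambda>(k, i, j) \<omega>. E m k \<omega> i j)
                          ({1..n} \<times> {..<m} \<times> {..<p m})"
    and E_distr: "\<And>m k i j. k \<in> {1..n} \<Longrightarrow> i < m \<Longrightarrow> j < p m \<Longrightarrow>
                   distr M borel (\<lambda>\<omega>. E m k \<omega> i j) = \<mu>"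
    and mu_mean: "integrable \<mu> (\<lambda>x. x)" "(\<integral>x. x \<partial>\<mu>) = 0"
    and mu_var: "(\<integral>x. x\<^sup>2 \<partial>\<mu>) = 1"
    and mu_mom: "\<exists>\<epsilon>>0. integrable \<mu> (\<lambda>x. \<bar>x\<bar> powr (4 + \<epsilon>))"
  defines "Abar \<equiv> \<lambda>m \<omega> i j. (1 / real n) * (\<Sum>k\<in>{1..n}. A m i j + mprod m (Sroot m) (E m k \<omega>) i j)"
    and "U \<equiv> \<lambda>(m::nat) (i::nat) (j::nat). (1::real)"
  shows "(AE \<omega> in M. (\<lambda>m. \<bar>tr_mult_transp m (p m) (Abar m \<omega>) (U m) / (real m * real (p m))
                          - tr_mult_transp m (p m) (A m) (U m) / (real m * real (p m))\<bar>) \<longlonglongrightarrow> 0) \<and>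
         (AE \<omega> in M. (\<lambda>m. \<bar>tr_mult_transp m (p m) (Abar m \<omega>) (A m) / (real m * real (p m))
                          - tr_mult_transp m (p m) (A m) (A m) / (real m * real (p m))\<bar>) \<longlonglongrightarrow> 0) \<and>
         (AE \<omega> in M. (\<lambda>m. \<bar>tr_mult_transp m (p m) (Abar m \<omega>) (Abar m \<omega>) / (real m * real (p m))
                          - tr_mult_transp m (p m) (A m) (A m) / (real m * real (p m))
                          - mtrace m (Sigma m) / (real n * real m)\<bar>) \<longlonglongrightarrow> 0)"
proof -
  interpret prob_space M by (rule P)
  define X where "X m = (\<lambda>(k, i, j) \<omega>. E m k \<omega> i j)" for m
  define W where "W m \<omega> = mean_noise n m (Sroot m) (\<lambda>s. X m s \<omega>)" for m \<omega>
  have n: "n > 0" using n_gt by simp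
  obtain \<epsilon> where eps: "\<epsilon> > 0" "integrable \<mu> (\<lambda>x. \<bar>x\<bar> powr (4 + \<epsilon>))" using mu_mom by blast
  interpret iid_array M "\<lambda>m. entry_indices n m (p m)" X \<mu> \<epsilon>
  proof
    show "distr M borel (X m s) = \<mu>" if "s \<in> entry_indices n m (p m)" for m s
      using that E_distr by (auto simp: X_def entry_indices_def)
  qed (use E_indep mu_mean mu_var eps in \<open>auto simp: finite_entry_indices X_def entry_indices_def\<close>)
  interpret matrix_root m "Sroot m" "Sigma m" for m
    using Sroot_pd[of m] Sroot_sq[of _ m] by unfold_locales (auto simp: sym_pos_def_def)
  obtain B where B: "\<And>m. mtrace m (Sigma m) / real m \<le> B" using Sigma_bdd by blast
  obtain BA where BA: "\<And>m. tr_mult_transp m (p m) (A m) (A m) / (real m * real (p m)) \<le> BA" using A_bdd by blast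

  \<comment> \<open>The upper bound converts estimates in \<open>1 / p m\<close> into estimates in
    \<open>1 / m\<close>; the lower bound makes both dimensions positive.\<close>
  have "\<forall>\<^sub>F m in sequentially. c / 2 < real m / real (p m) \<and> real m / real (p m) < 2 * c"
    using order_tendstoD(1)[OF ratio, of "c / 2"] order_tendstoD(2)[OF ratio, of "2 * c"] c_pos
    by (simp add: eventually_conj)
  then obtain m0 where m0: "\<And>m. m \<ge> m0 \<Longrightarrow> c / 2 < real m / real (p m) \<and> real m / real (p m) < 2 * c"
    by (auto simp: eventually_sequentially)
  \<comment> \<open>A quotient with zero numerator or zero denominator is 0 and could not exceed
    \<open>c / 2\<close>.\<close>
  have pos: "m > 0" "p m > 0" if "m \<ge> m0" for m
    using m0[OF that] c_pos by (auto intro!: Nat.gr0I)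
  have p_le: "K / real (p m) \<le> K * (2 * c) / real m" if "m \<ge> m0" "0 \<le> K" for m K
  proof -
    have "K * (real m / real (p m)) \<le> K * (2 * c)" using m0[OF that(1)] that(2) by (intro mult_left_mono) auto
    then show ?thesis using pos[OF that(1)] by (simp add: field_simps)
  qed
  \<comment> \<open>The absolute value of \<open>B\<close> makes the constants nonnegative, as
    \<open>p_le\<close> requires.\<close>
  have trS: "mtrace m (Sigma m) \<le> \<bar>B\<bar> * real m" if "m \<ge> m0" for m
    using B[of m] pos[OF that] by (simp add: divide_le_eq) (smt (verit) mult_right_mono of_nat_0_le_iff)

  have linear: "AE \<omega> in M. (\<lambda>m. tr_mult_transp m (p m) (W m \<omega>) (G m) / (real m * real (p m))) \<longlonglongrightarrow> 0"
    if G: "\<And>m. m \<ge> m0 \<Longrightarrow> tr_mult_transp m (p m) (G m) (G m) \<le> \<bar>B'\<bar> * (real m * real (p m))" for G B'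
    unfolding W_def tr_mean_noise_linear
  proof (rule AE_linear_forms_tendsto_zero)
    show "(\<Sum>s\<in>entry_indices n m (p m). (lin_coeff n m (p m) (Sroot m) (G m) s)\<^sup>2) \<le> \<bar>B\<bar> * \<bar>B'\<bar> * (2 * c) / real m"
      if m: "m \<ge> m0" for m
      using sum_lin_coeff_square_le[OF trS[OF m] n pos(2,1)[OF m] G[OF m]] p_le[OF m, of "\<bar>B\<bar> * \<bar>B'\<bar>"] by simp
  qed
  have linear_U: "AE \<omega> in M. (\<lambda>m. tr_mult_transp m (p m) (W m \<omega>) (U m) / (real m * real (p m))) \<longlonglongrightarrow> 0"
    \<comment> \<open>The constant is 1 because the squared entries of \<open>U m\<close> sum to
      \<open>m * p m\<close>.\<close>
    by (rule linear[of U 1]) (simp add: tr_mult_transp_def U_def)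
  have linear_A: "AE \<omega> in M. (\<lambda>m. tr_mult_transp m (p m) (W m \<omega>) (A m) / (real m * real (p m))) \<longlonglongrightarrow> 0"
  proof (rule linear[of A BA])
    fix m assume "m \<ge> m0"
    then have "tr_mult_transp m (p m) (A m) (A m) \<le> BA * (real m * real (p m))"
      using BA[of m] pos[of m] by (simp add: divide_le_eq)
    also have "\<dots> \<le> \<bar>BA\<bar> * (real m * real (p m))" by (intro mult_right_mono) auto
    finally show "tr_mult_transp m (p m) (A m) (A m) \<le> \<bar>BA\<bar> * (real m * real (p m))" .
  qed
  have quadratic: "AE \<omega> in M. (\<lambda>m. tr_mult_transp m (p m) (W m \<omega>) (W m \<omega>) / (real m * real (p m))
      - (\<Sum>s\<in>entry_indices n m (p m). quad_coeff n m (p m) (Sigma m) s s)) \<longlonglongrightarrow> 0"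
    unfolding W_def tr_mean_noise_quadratic
  proof (rule AE_centered_quadratic_forms_tendsto_zero)
    \<comment> \<open>One constant covering both the bound with \<open>\<bar>B\<bar>\<^sup>2\<close>
      for the sum of squares and the bound with \<open>\<bar>B\<bar>\<close> for the
      diagonal.\<close>
    let ?C = "(\<bar>B\<bar>\<^sup>2 + \<bar>B\<bar>) * (2 * c)"
    show "0 \<le> ?C" using c_pos by simp
    fix m assume m: "m \<ge> m0"
    have le: "(\<bar>B\<bar>\<^sup>2 + \<bar>B\<bar>) / real (p m) \<le> ?C / real m" by (rule p_le[OF m]) simp
    have "\<bar>B\<bar>\<^sup>2 / real (p m) \<le> (\<bar>B\<bar>\<^sup>2 + \<bar>B\<bar>) / real (p m)" "\<bar>B\<bar> / real (p m) \<le> (\<bar>B\<bar>\<^sup>2 + \<bar>B\<bar>) / real (p m)"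
      by (intro divide_right_mono; simp)+
    note le1 = order_trans[OF this(1) le] and le2 = order_trans[OF this(2) le]
    show "(\<Sum>s\<in>entry_indices n m (p m). \<Sum>t\<in>entry_indices n m (p m). (quad_coeff n m (p m) (Sigma m) s t)\<^sup>2) \<le> ?C / real m"
      by (rule order_trans[OF sum_quad_coeff_square_le[OF trS[OF m] n pos(2,1)[OF m]] le1])
    show "\<bar>quad_coeff n m (p m) (Sigma m) s s\<bar> \<le> ?C / real m" if "s \<in> entry_indices n m (p m)" for s
      by (rule order_trans[OF abs_quad_coeff_diagonal_le[OF trS[OF m] n pos(2,1)[OF m] that] le2])
  qed

  have Abar: "Abar m \<omega> i j = A m i j + W m \<omega> i j" for m \<omega> i j
    using n by (simp add: Abar_def W_def mean_noise_def X_def sum.distrib distrib_left)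
  have lin: "tr_mult_transp m (p m) (Abar m \<omega>) G / (real m * real (p m)) - tr_mult_transp m (p m) (A m) G / (real m * real (p m))
      = tr_mult_transp m (p m) (W m \<omega>) G / (real m * real (p m))" for m \<omega> G
    unfolding tr_mult_transp_def Abar by (simp add: distrib_right sum.distrib add_divide_distrib)
  have "tr_mult_transp m (p m) (Abar m \<omega>) (Abar m \<omega>)
      = tr_mult_transp m (p m) (A m) (A m) + 2 * tr_mult_transp m (p m) (W m \<omega>) (A m)
        + tr_mult_transp m (p m) (W m \<omega>) (W m \<omega>)" for m \<omega>
    unfolding tr_mult_transp_def Abar sum_distrib_left
    by (simp add: algebra_simps flip: sum.distrib)
  then have quad: "tr_mult_transp m (p m) (Abar m \<omega>) (Abar m \<omega>) / (real m * real (p m))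
        - tr_mult_transp m (p m) (A m) (A m) / (real m * real (p m)) - mtrace m (Sigma m) / (real n * real m)
      = 2 * (tr_mult_transp m (p m) (W m \<omega>) (A m) / (real m * real (p m)))
        + (tr_mult_transp m (p m) (W m \<omega>) (W m \<omega>) / (real m * real (p m))
           - (\<Sum>s\<in>entry_indices n m (p m). quad_coeff n m (p m) (Sigma m) s s))" if "m \<ge> m0" for m \<omega>
    by (simp add: sum_quad_coeff_diagonal[OF n pos(2)[OF that]] add_divide_distrib)

  show ?thesis
  proof (intro conjI)
    show "AE \<omega> in M. (\<lambda>m. \<bar>tr_mult_transp m (p m) (Abar m \<omega>) (U m) / (real m * real (p m))
        - tr_mult_transp m (p m) (A m) (U m) / (real m * real (p m))\<bar>) \<longlonglongrightarrow> 0"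
      unfolding lin using linear_U by eventually_elim (rule tendsto_rabs_zero)
    show "AE \<omega> in M. (\<lambda>m. \<bar>tr_mult_transp m (p m) (Abar m \<omega>) (A m) / (real m * real (p m))
        - tr_mult_transp m (p m) (A m) (A m) / (real m * real (p m))\<bar>) \<longlonglongrightarrow> 0"
      unfolding lin using linear_A by eventually_elim (rule tendsto_rabs_zero)
    show "AE \<omega> in M. (\<lambda>m. \<bar>tr_mult_transp m (p m) (Abar m \<omega>) (Abar m \<omega>) / (real m * real (p m))
        - tr_mult_transp m (p m) (A m) (A m) / (real m * real (p m))
        - mtrace m (Sigma m) / (real n * real m)\<bar>) \<longlonglongrightarrow> 0"
      using linear_A quadratic
    proof eventually_elim
      case (elim \<omega>)
      show ?case
      \<comment> \<open>The error is twice the cross term plus the centred quadratic form, each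
        tending to zero. The identity is available from \<open>m0\<close> on, where
        \<open>p m > 0\<close> identifies the centring with the trace of the covariance.\<close>
      proof (rule tendsto_rabs_zero, rule Lim_transform_eventually)
        show "(\<lambda>m. 2 * (tr_mult_transp m (p m) (W m \<omega>) (A m) / (real m * real (p m)))
          + (tr_mult_transp m (p m) (W m \<omega>) (W m \<omega>) / (real m * real (p m))
           - (\<Sum>s\<in>entry_indices n m (p m). quad_coeff n m (p m) (Sigma m) s s))) \<longlonglongrightarrow> 0"
          by (rule tendsto_add_zero[OF tendsto_mult_right_zero[OF elim(1)] elim(2)])
      qed (rule eventually_sequentiallyI[where c = m0], rule quad[symmetric])
    qed
  qed
qed

end
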